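(* The lattice of subvarieties of $\mathsf{V}(SR_6)$ is a four-element chain, namely $$\mathbf{T}\subset \mathsf{V}(S_c(a))\subset \mathsf{V}(S_c(ab))\subset \mathsf{V}(SR_6),$$ where $\mathbf{T}$ denotes the trivial variety.
   Context: An ai-semiring is an algebra $(S,+,\cdot)$ (two binary operations, no constants) such that $(S,+)$ is a commutative idempotent semigroup, $(S,\cdot)$ is a semigroup, and multiplication distributes over addition on both sides. $\mathsf{V}(A)$ denotes the variety generated by $A$. $SR_6$ is the ai-semiring with underlying set $\{1,2,3,4,5,6\}$ and the following commutative operations. Addition: $i+i=i$ for all $i$; $2+5=5+2=2$; $4+6=6+4=4$; all other sums of two distinct elements equal $1$. Multiplication: $2\cdot 6=6\cdot 2=3$, $4\cdot 5=5\cdot 4=3$, $5\cdot 6=6\cdot 5=3$; all other products equal $1$. For a word $\mathbf{w}$ in a free commutative semigroup, $S_c(\mathbf{w})$ is the set of all nonempty subwords (divisors) of $\mathbf{w}$ together with a new symbol $0$, where $\mathbf{u}+\mathbf{u}=\mathbf{u}$ and $\mathbf{u}+\mathbf{v}=0$ if $\mathbf{u}\neq\mathbf{v}$, and $\mathbf{u}\cdot\mathbf{v}$ is the product $\mathbf{u}\mathbf{v}$ if it is a nonempty subword of $\mathbf{w}$ and $0$ otherwise (in particular $0$ is absorbing for both operations). Thus $S_c(a)=\{a,0\}$ with $a\cdot a=0$, and, for distinct letters $a,b$, $S_c(ab)=\{a,b,ab,0\}$, in which the only nonzero product is $a\cdot b=b\cdot a=ab$. *)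

theory Defs
  imports "HOL-Library.FuncSet" "HOL-Library.Multiset"
begin

section \<open>Algebras with two binary operations\<close>

text \<open>The values of the operations outside the carrier are irrelevant.\<close>

record 'a alg =
  carrier :: "'a set"
  add :: "'a \<Rightarrow> 'a \<Rightarrow> 'a"
  mul :: "'a \<Rightarrow> 'a \<Rightarrow> 'a"

definition ai_semiring :: "'a alg \<Rightarrow> bool" where
  "ai_semiring A \<longleftrightarrow>
     carrier A \<noteq> {} \<and>
     (\<forall>x\<in>carrier A. \<forall>y\<in>carrier A. add A x y \<in> carrier A \<and> mul A x y \<in> carrier A) \<and>
     (\<forall>x\<in>carrier A. add A x x = x) \<and>
     (\<forall>x\<in>carrier A. \<forall>y\<in>carrier A. add A x y = add A y x) \<and>
     (\<forall>x\<in>carrier A. \<forall>y\<in>carrier A. \<forall>z\<in>carrier A.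
        add A (add A x y) z = add A x (add A y z) \<and>
        mul A (mul A x y) z = mul A x (mul A y z) \<and>
        mul A x (add A y z) = add A (mul A x y) (mul A x z) \<and>
        mul A (add A x y) z = add A (mul A x z) (mul A y z))"

definition alg_hom :: "('a \<Rightarrow> 'b) \<Rightarrow> 'a alg \<Rightarrow> 'b alg \<Rightarrow> bool" where
  "alg_hom h A B \<longleftrightarrow>
     h ` carrier A \<subseteq> carrier B \<and>
     (\<forall>x\<in>carrier A. \<forall>y\<in>carrier A.
        h (add A x y) = add B (h x) (h y) \<and> h (mul A x y) = mul B (h x) (h y))"

definition hom_image :: "'b alg \<Rightarrow> 'a alg \<Rightarrow> bool" where
  "hom_image B A \<longleftrightarrow> (\<exists>h. alg_hom h A B \<and> h ` carrier A = carrier B)"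

definition alg_iso :: "'a alg \<Rightarrow> 'b alg \<Rightarrow> bool" where
  "alg_iso A B \<longleftrightarrow> (\<exists>h. alg_hom h A B \<and> bij_betw h (carrier A) (carrier B))"

definition subalgebra :: "'a alg \<Rightarrow> 'a alg \<Rightarrow> bool" where
  "subalgebra C A \<longleftrightarrow>
     carrier C \<noteq> {} \<and> carrier C \<subseteq> carrier A \<and>
     (\<forall>x\<in>carrier C. \<forall>y\<in>carrier C.
        add A x y \<in> carrier C \<and> mul A x y \<in> carrier C \<and>
        add C x y = add A x y \<and> mul C x y = mul A x y)"

definition direct_product :: "'i set \<Rightarrow> ('i \<Rightarrow> 'a alg) \<Rightarrow> ('i \<Rightarrow> 'a) alg" where
  "direct_product I A =
     \<lparr>carrier = (\<Pi>\<^sub>E i\<in>I. carrier (A i)),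
      add = (\<lambda>f g. \<lambda>i\<in>I. add (A i) (f i) (g i)),
      mul = (\<lambda>f g. \<lambda>i\<in>I. mul (A i) (f i) (g i))\<rparr>"

section \<open>Varieties\<close>

text \<open>
  A class of algebras is represented by the set of its members whose carrier lies in a universe
  type \<open>'u\<close>, which is meant to be infinite.  A variety is a class of ai-semirings closed under
  homomorphic images, subalgebras and direct products.  As the product of a family of algebras
  over \<open>'u\<close> is an algebra over \<open>'u \<Rightarrow> 'u\<close> and may be too large to have a copy over \<open>'u\<close>, the three
  closure conditions are imposed jointly: every algebra over \<open>'u\<close> that is a homomorphic image of
  a subalgebra of a product of members is a member.

  Taking index sets in \<open>'u\<close> is no restriction: if \<open>B\<close> over an infinite \<open>'u\<close> is a homomorphic image
  of a subalgebra of a product of any family, then it is one of a subalgebra generated by at most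
  \<open>|'u|\<close> elements, whose elements are separated by at most \<open>|'u|\<close> coordinates.  Since every variety
  is generated by its countable members, it is determined by its members over \<open>'u\<close>, so that
  the sets below correspond, preserving inclusion, to the varieties of ai-semirings.

  The index set may be empty, so every variety contains the one-element algebras.
\<close>

definition ai_variety :: "'u alg set \<Rightarrow> bool" where
  "ai_variety K \<longleftrightarrow>
     (\<forall>A\<in>K. ai_semiring A) \<and>
     (\<forall>(I :: 'u set) A C B.
        (\<forall>i\<in>I. A i \<in> K) \<longrightarrow> subalgebra C (direct_product I A) \<longrightarrow> hom_image B C \<longrightarrow> B \<in> K)"

text \<open>The least variety containing \<open>A\<close>.  As \<open>A\<close> need not live in the universe \<open>'u\<close>, containing \<open>A\<close>
  means containing an isomorphic copy of it; a finite \<open>A\<close> always has one over an infinite \<open>'u\<close>.\<close>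

definition variety_of :: "'a alg \<Rightarrow> 'u alg set" where
  "variety_of A = \<Inter> {K. ai_variety K \<and> (\<exists>B\<in>K. alg_iso A B)}"

definition trivial_variety :: "'u alg set" where
  "trivial_variety = {A. ai_semiring A \<and> card (carrier A) = 1}"

definition subvarieties :: "'u alg set \<Rightarrow> 'u alg set set" where
  "subvarieties V = {W. ai_variety W \<and> W \<subseteq> V}"

section \<open>The specific ai-semirings\<close>

definition SR6 :: "nat alg" where
  "SR6 =
     \<lparr>carrier = {1..6},
      add = (\<lambda>i j. if i = j then i
                   else if {i, j} = {2, 5} then 2
                   else if {i, j} = {4, 6} then 4
                   else 1),
      mul = (\<lambda>i j. if {i, j} \<in> {{2, 6}, {4, 5}, {5, 6}} then 3 else 1)\<rparr>"

text \<open>Words of the free commutative semigroup are nonempty multisets of letters; the product of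
  words is multiset sum and divisibility is multiset inclusion.  The symbol \<open>0\<close> is \<open>None\<close>.\<close>

definition Sc :: "'x multiset \<Rightarrow> 'x multiset option alg" where
  "Sc w =
     \<lparr>carrier = insert None (Some ` {u. u \<noteq> {#} \<and> u \<subseteq># w}),
      add = (\<lambda>p q. if p = q then p else None),
      mul = (\<lambda>p q. case (p, q) of
                     (Some u, Some v) \<Rightarrow> if u + v \<subseteq># w then Some (u + v) else None
                   | _ \<Rightarrow> None)\<rparr>"

end

theory Submission
  imports Defs
begin

text \<open>
  By Birkhoff's theorem a variety is the class of models of its identities, so the problem becomes
  one about identities.  It is convenient to see \<open>Sc {#a#}\<close> and \<open>Sc {#a, b#}\<close> inside \<open>SR6\<close>, as the
  subalgebras \<open>{1, 3}\<close> and \<open>{1, 3, 5, 6}\<close>; here \<open>1\<close> is the zero, absorbing for both operations.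

  In every member of the variety of \<open>SR6\<close> squares and products of three elements are zero, so a
  term amounts to a set of letters together with a graph whose edges are its two-letter words
  (\<open>nil_ai_semiring.eval_le_iff\<close>).  In \<open>SR6\<close> the value \<open>3\<close> is minimal: a term has
  this value exactly if all its letters and edges do and it has no longer words.  The
  assignments under which the
  two sides take the value \<open>3\<close> already decide whether an identity holds in one of the three
  algebras (\<open>equal_solutions_imp_identity\<close>), so an identity that fails there can be taken to fail
  with one side equal to \<open>3\<close> and the other not.

  Let \<open>W\<close> be a subvariety, and suppose that one of its identities fails in \<open>SR6\<close> in this way.
  Replace the elements of \<open>SR6\<close> by expressions in \<open>x1, x2, y1, y2\<close> that reproduce all products
  equal to \<open>3\<close> below \<open>q = x1 y1 + x2 y1 + x2 y2\<close>, and turn \<open>2\<close> times \<open>4\<close>, the only product of an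
  element of \<open>{2, 5}\<close> with one of \<open>{4, 6}\<close> that is not \<open>3\<close>, into something above \<open>x1 y2\<close>.  The identity
  then gives \<open>x1 y2 \<le> q\<close> in \<open>W\<close> (\<open>path_law_if_identity_fails\<close>).  If it fails in \<open>{1, 3, 5, 6}\<close>,
  where \<open>2\<close> and \<open>4\<close> are absent, it gives \<open>q = 0\<close>, hence \<open>x y = 0\<close>; and if it fails in \<open>{1, 3}\<close>, it
  gives \<open>x = 0\<close>.

  Conversely, \<open>x1 y2 \<le> q\<close> allows adding to the graph of a term all pairs joined by a walk of odd length.
  Two bipartite graphs with the same proper colourings have the same such pairs, because the
  colours of a whole component may be exchanged; so the path law yields every identity of
  \<open>{1, 3, 5, 6}\<close> (\<open>path_law_imp_identity\<close>).  Likewise \<open>x y = 0\<close> yields every identity of \<open>{1, 3}\<close>.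
  Hence, going down the chain, either the identities of \<open>W\<close> all hold in the algebra reached, and \<open>W\<close>
  is its variety, or \<open>W\<close> lies in the next smaller variety.
\<close>

section \<open>Terms and identities\<close>

datatype 'v trm = Var 'v | Plus "'v trm" "'v trm" | Times "'v trm" "'v trm"

primrec eval :: "'a alg \<Rightarrow> ('v \<Rightarrow> 'a) \<Rightarrow> 'v trm \<Rightarrow> 'a" where
  "eval A v (Var x) = v x"
| "eval A v (Plus s t) = add A (eval A v s) (eval A v t)"
| "eval A v (Times s t) = mul A (eval A v s) (eval A v t)"

definition holds :: "'a alg \<Rightarrow> 'v trm \<Rightarrow> 'v trm \<Rightarrow> bool" where
  "holds A s t \<longleftrightarrow> (\<forall>v. range v \<subseteq> carrier A \<longrightarrow> eval A v s = eval A v t)"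

definition closed_alg :: "'a alg \<Rightarrow> bool" where
  "closed_alg A \<longleftrightarrow>
     carrier A \<noteq> {} \<and>
     (\<forall>x\<in>carrier A. \<forall>y\<in>carrier A. add A x y \<in> carrier A \<and> mul A x y \<in> carrier A)"

text \<open>
  The laws of ai-semirings as pairs of terms, so that their preservation under homomorphic images,
  subalgebras and products is an instance of the preservation of identities.
\<close>

definition ai_axioms :: "(nat trm \<times> nat trm) set" where
  "ai_axioms =
     (let x = Var 0; y = Var 1; z = Var 2 in
       {(Plus x x, x), (Plus x y, Plus y x),
        (Plus (Plus x y) z, Plus x (Plus y z)),
        (Times (Times x y) z, Times x (Times y z)),
        (Times x (Plus y z), Plus (Times x y) (Times x z)),
        (Times (Plus x y) z, Plus (Times x z) (Times y z))})"

lemma ai_semiring_iff_axioms: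
  "ai_semiring A \<longleftrightarrow> closed_alg A \<and> (\<forall>(s, t)\<in>ai_axioms. holds A s t)"
proof
  assume *: "ai_semiring A"
  have "holds A s t" if st: "(s, t) \<in> ai_axioms" for s t
    unfolding holds_def
  proof (intro allI impI)
    fix v :: "nat \<Rightarrow> 'a" assume "range v \<subseteq> carrier A"
    then have v: "v 0 \<in> carrier A" "v 1 \<in> carrier A" "v 2 \<in> carrier A"
      by auto
    have "add A (v 0) (v 0) = v 0" "add A (v 0) (v 1) = add A (v 1) (v 0)"
      "add A (add A (v 0) (v 1)) (v 2) = add A (v 0) (add A (v 1) (v 2))"
      "mul A (mul A (v 0) (v 1)) (v 2) = mul A (v 0) (mul A (v 1) (v 2))"
      "mul A (v 0) (add A (v 1) (v 2)) = add A (mul A (v 0) (v 1)) (mul A (v 0) (v 2))"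
      "mul A (add A (v 0) (v 1)) (v 2) = add A (mul A (v 0) (v 2)) (mul A (v 1) (v 2))"
      using * v unfolding ai_semiring_def by blast+
    then show "eval A v s = eval A v t"
      using st unfolding ai_axioms_def Let_def
      by (elim insertE emptyE) (simp_all only: prod.inject eval.simps)
  qed
  then show "closed_alg A \<and> (\<forall>(s, t)\<in>ai_axioms. holds A s t)"
    using * by (auto simp: ai_semiring_def closed_alg_def)
next
  assume *: "closed_alg A \<and> (\<forall>(s, t)\<in>ai_axioms. holds A s t)"
  have "add A x x = x \<and> add A x y = add A y x
      \<and> add A (add A x y) z = add A x (add A y z) \<and> mul A (mul A x y) z = mul A x (mul A y z)
      \<and> mul A x (add A y z) = add A (mul A x y) (mul A x z)
      \<and> mul A (add A x y) z = add A (mul A x z) (mul A y z)"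
    if xyz: "x \<in> carrier A" "y \<in> carrier A" "z \<in> carrier A" for x y z
  proof -
    define w :: "nat \<Rightarrow> 'a" where "w n = (if n = 0 then x else if n = 1 then y else z)" for n
    have w [simp]: "w 0 = x" "w 1 = y" "w (Suc 0) = y" "w 2 = z"
      by (simp_all add: w_def)
    have "range w \<subseteq> carrier A"
      using xyz by (auto simp: w_def)
    then have inst: "eval A w s = eval A w t" if "(s, t) \<in> ai_axioms" for s t
      using * that unfolding holds_def by blast
    show ?thesis
    proof (intro conjI)
      show "add A x x = x"
        using inst[of "Plus (Var 0) (Var 0)" "Var 0"]
        by (simp add: ai_axioms_def Let_def)
      show "add A x y = add A y x"
        using inst[of "Plus (Var 0) (Var 1)" "Plus (Var 1) (Var 0)"]
        by (simp add: ai_axioms_def Let_def)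
      show "add A (add A x y) z = add A x (add A y z)"
        using inst[of "Plus (Plus (Var 0) (Var 1)) (Var 2)" "Plus (Var 0) (Plus (Var 1) (Var 2))"]
        by (simp add: ai_axioms_def Let_def)
      show "mul A (mul A x y) z = mul A x (mul A y z)"
        using inst[of "Times (Times (Var 0) (Var 1)) (Var 2)"
          "Times (Var 0) (Times (Var 1) (Var 2))"]
        by (simp add: ai_axioms_def Let_def)
      show "mul A x (add A y z) = add A (mul A x y) (mul A x z)"
        using inst[of "Times (Var 0) (Plus (Var 1) (Var 2))"
          "Plus (Times (Var 0) (Var 1)) (Times (Var 0) (Var 2))"]
        by (simp add: ai_axioms_def Let_def)
      show "mul A (add A x y) z = add A (mul A x z) (mul A y z)"
        using inst[of "Times (Plus (Var 0) (Var 1)) (Var 2)"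
          "Plus (Times (Var 0) (Var 2)) (Times (Var 1) (Var 2))"]
        by (simp add: ai_axioms_def Let_def)
    qed
  qed
  then show "ai_semiring A"
    using * unfolding ai_semiring_def closed_alg_def by blast
qed

lemma ai_semiring_closed: "ai_semiring A \<Longrightarrow> closed_alg A"
  by (simp add: ai_semiring_iff_axioms)

lemma eval_in_carrier:
  assumes "closed_alg A" "range v \<subseteq> carrier A"
  shows "eval A v t \<in> carrier A"
  using assms by (induction t) (auto simp: closed_alg_def)

lemma eval_cong_operations:
  "add A = add B \<Longrightarrow> mul A = mul B \<Longrightarrow> eval A v t = eval B v t"
  by (induction t) auto

lemma eval_hom:
  assumes "alg_hom h A B" "closed_alg A" "range v \<subseteq> carrier A"
  shows "h (eval A v t) = eval B (h \<circ> v) t"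
proof (induction t)
  case (Plus s t)
  then show ?case
    using assms eval_in_carrier[OF assms(2,3)] by (simp add: alg_hom_def)
next
  case (Times s t)
  then show ?case
    using assms eval_in_carrier[OF assms(2,3)] by (simp add: alg_hom_def)
qed simp

lemma hom_image_closed:
  assumes "closed_alg A" "hom_image B A"
  shows "closed_alg B"
proof -
  obtain h where h: "alg_hom h A B" "h ` carrier A = carrier B"
    using assms(2) by (auto simp: hom_image_def)
  have "add B (h x) (h y) \<in> carrier B \<and> mul B (h x) (h y) \<in> carrier B"
    if "x \<in> carrier A" "y \<in> carrier A" for x y
  proof -
    have "h (add A x y) \<in> carrier B" "h (mul A x y) \<in> carrier B"
      using that assms(1) h(2) unfolding closed_alg_def by blast+
    then show ?thesis
      using h(1) that by (simp add: alg_hom_def)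
  qed
  then show ?thesis
    using assms(1) h(2) unfolding closed_alg_def by (metis (no_types, lifting) imageE image_is_empty)
qed

lemma hom_image_holds:
  fixes s t :: "'v trm"
  assumes "closed_alg A" "hom_image B A" "holds A s t"
  shows "holds B s t"
  unfolding holds_def
proof (intro allI impI)
  fix v :: "'v \<Rightarrow> _" assume v: "range v \<subseteq> carrier B"
  obtain h where h: "alg_hom h A B" "h ` carrier A = carrier B"
    using assms(2) by (auto simp: hom_image_def)
  have "\<forall>x. \<exists>y. y \<in> carrier A \<and> h y = v x"
    using v h(2) by (metis imageE range_subsetD)
  then obtain w where w: "\<And>x. w x \<in> carrier A \<and> h (w x) = v x"
    by metis
  then have "range w \<subseteq> carrier A" and "h \<circ> w = v"
    by auto
  then show "eval B v s = eval B v t"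
    using eval_hom[OF h(1) assms(1), of w] assms(3) unfolding holds_def by metis
qed

lemma subalgebra_closed: "subalgebra C A \<Longrightarrow> closed_alg C"
  by (auto simp: subalgebra_def closed_alg_def)

lemma subalgebra_holds:
  fixes s t :: "'v trm"
  assumes "subalgebra C A" "holds A s t"
  shows "holds C s t"
  unfolding holds_def
proof (intro allI impI)
  fix v :: "'v \<Rightarrow> _" assume v: "range v \<subseteq> carrier C"
  have "alg_hom id C A"
    using assms(1) by (auto simp: subalgebra_def alg_hom_def)
  moreover have "range v \<subseteq> carrier A"
    using v assms(1) by (auto simp: subalgebra_def)
  ultimately show "eval C v s = eval C v t"
    using eval_hom[OF _ subalgebra_closed[OF assms(1)] v, of id] assms(2)
    by (simp add: holds_def)
qed

lemma product_closed:
  assumes "\<And>i. i \<in> I \<Longrightarrow> closed_alg (A i)"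
  shows "closed_alg (direct_product I A)"
  using assms by (auto simp: closed_alg_def direct_product_def PiE_eq_empty_iff PiE_iff)

lemma product_holds:
  fixes s t :: "'v trm"
  assumes "\<And>i. i \<in> I \<Longrightarrow> closed_alg (A i)" "\<And>i. i \<in> I \<Longrightarrow> holds (A i) s t"
  shows "holds (direct_product I A) s t"
  unfolding holds_def
proof (intro allI impI)
  let ?P = "direct_product I A"
  fix v :: "'v \<Rightarrow> _" assume v: "range v \<subseteq> carrier ?P"
  have P: "closed_alg ?P"
    using assms(1) by (rule product_closed)
  show "eval ?P v s = eval ?P v t"
  proof (rule PiE_ext)
    show "eval ?P v s \<in> (\<Pi>\<^sub>E i\<in>I. carrier (A i))" "eval ?P v t \<in> (\<Pi>\<^sub>E i\<in>I. carrier (A i))"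
      using eval_in_carrier[OF P v] by (simp_all add: direct_product_def)
    fix i assume i: "i \<in> I"
    have hom: "alg_hom (\<lambda>f. f i) ?P (A i)"
      using i by (auto simp: alg_hom_def direct_product_def)
    have "range ((\<lambda>f. f i) \<circ> v) \<subseteq> carrier (A i)"
      using v hom unfolding alg_hom_def by fastforce
    then show "eval ?P v s i = eval ?P v t i"
      using eval_hom[OF hom P v] assms(2)[OF i] by (simp add: holds_def)
  qed
qed

lemma iso_holds_iff:
  fixes s t :: "'v trm"
  assumes "alg_iso A B" "closed_alg A"
  shows "holds A s t \<longleftrightarrow> holds B s t"
proof
  obtain h where h: "alg_hom h A B" "bij_betw h (carrier A) (carrier B)"
    using assms(1) by (auto simp: alg_iso_def)
  have image: "hom_image B A"
    using h by (auto simp: hom_image_def bij_betw_def)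
  then show "holds A s t \<Longrightarrow> holds B s t"
    using hom_image_holds assms(2) by blast
  assume B: "holds B s t"
  show "holds A s t"
    unfolding holds_def
  proof (intro allI impI)
    fix v :: "'v \<Rightarrow> _" assume v: "range v \<subseteq> carrier A"
    have "range (h \<circ> v) \<subseteq> carrier B"
      using v h(1) by (auto simp: alg_hom_def)
    then have "h (eval A v s) = h (eval A v t)"
      using B eval_hom[OF h(1) assms(2) v] by (simp add: holds_def)
    then show "eval A v s = eval A v t"
      using h(2) eval_in_carrier[OF assms(2) v] by (auto simp: bij_betw_def dest: inj_onD)
  qed
qed

lemma iso_ai_semiring:
  assumes "alg_iso A B" "ai_semiring A"
  shows "ai_semiring B"
proof -
  have "hom_image B A"
    using assms(1) by (auto simp: alg_iso_def hom_image_def bij_betw_def)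
  then show ?thesis
    using assms(2) hom_image_closed hom_image_holds unfolding ai_semiring_iff_axioms by blast
qed

section \<open>Varieties as equational classes\<close>

definition models :: "('u trm \<times> 'u trm) set \<Rightarrow> 'u alg set" where
  "models \<Gamma> = {B. ai_semiring B \<and> (\<forall>(s, t)\<in>\<Gamma>. holds B s t)}"

definition identities :: "'u alg set \<Rightarrow> ('u trm \<times> 'u trm) set" where
  "identities K = {(s, t). \<forall>A\<in>K. holds A s t}"

lemma models_variety: "ai_variety (models \<Gamma>)"
  unfolding ai_variety_def
proof (intro conjI ballI allI impI)
  show "A \<in> models \<Gamma> \<Longrightarrow> ai_semiring A" for A
    by (simp add: models_def)
next
  fix I :: "'a set" and A C and B :: "'a alg"
  assume A: "\<forall>i\<in>I. A i \<in> models \<Gamma>" and C: "subalgebra C (direct_product I A)"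
    and B: "hom_image B C"
  have closed: "\<And>i. i \<in> I \<Longrightarrow> closed_alg (A i)"
    using A by (simp add: models_def ai_semiring_closed)
  have transfer: "holds B s t" if "\<And>i. i \<in> I \<Longrightarrow> holds (A i) s t" for s t :: "'v trm"
    using hom_image_holds[OF subalgebra_closed[OF C] B]
      subalgebra_holds[OF C product_holds[OF closed that]] by blast
  have "closed_alg B"
    using hom_image_closed[OF subalgebra_closed[OF C] B] .
  moreover have "\<forall>(s, t)\<in>ai_axioms. holds B s t"
    using transfer A unfolding models_def ai_semiring_iff_axioms by blast
  moreover have "\<forall>(s, t)\<in>\<Gamma>. holds B s t"
    using transfer A unfolding models_def by blast
  ultimately show "B \<in> models \<Gamma>"
    by (simp add: models_def ai_semiring_iff_axioms)
qed

text \<open>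
  An infinite universe has room for codes of all pairs of terms: a pairing function on the universe
  and three tags encode the term constructors.  Such codes serve as the indices of a product.
\<close>

lemma terms_embed:
  assumes "infinite (UNIV :: 'u set)"
  obtains enc :: "'u trm \<times> 'u trm \<Rightarrow> 'u" where "inj enc"
proof -
  obtain p :: "'u \<times> 'u \<Rightarrow> 'u" where "bij_betw p (UNIV \<times> UNIV) UNIV"
    using card_of_ordIso[THEN iffD2, OF card_of_Times_same_infinite[OF assms]] by blast
  then have p: "inj p"
    by (simp add: bij_betw_def)
  obtain c0 c1 c2 :: 'u where c: "c0 \<noteq> c1" "c0 \<noteq> c2" "c1 \<noteq> c2"
  proof -
    obtain c0 c1 :: 'u where "c1 \<notin> {c0}"
      using ex_new_if_finite[OF assms, of "{undefined}"] by auto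
    moreover obtain c2 where "c2 \<notin> {c0, c1}"
      using ex_new_if_finite[OF assms, of "{c0, c1}"] by auto
    ultimately show thesis
      using that[of c0 c1 c2] by auto
  qed
  define code where "code = rec_trm (\<lambda>x. p (c0, x)) (\<lambda>_ _ m n. p (c1, p (m, n)))
    (\<lambda>_ _ m n. p (c2, p (m, n)))"
  have code [simp]: "code (Var x) = p (c0, x)" "code (Plus s t) = p (c1, p (code s, code t))"
    "code (Times s t) = p (c2, p (code s, code t))" for x s t
    by (simp_all add: code_def)
  have p_eq [simp]: "p x = p y \<longleftrightarrow> x = y" for x y
    using p by (simp add: inj_eq)
  have "code s = code t \<Longrightarrow> s = t" for s t
  proof (induction s arbitrary: t)
    case (Var x) then show ?case using c by (cases t) auto
  next
    case (Plus s1 s2) then show ?case using c by (cases t) auto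
  next
    case (Times s1 s2) then show ?case using c by (cases t) auto
  qed
  then have "inj (\<lambda>(s, t). p (code s, code t))"
    by (auto simp: inj_on_def)
  then show thesis
    by (rule that)
qed

text \<open>
  Birkhoff's theorem.  The elements of a model \<open>B\<close> of the identities of \<open>W\<close> are used as the variables.  For
  each pair of terms that is not an identity of \<open>W\<close>, pick a member of \<open>W\<close> and an assignment that
  separate it.  In the product of these members the values of the terms form a subalgebra, in which
  terms agree only if they form an identity of \<open>W\<close>; hence evaluation in \<open>B\<close> is a well-defined
  homomorphism from it onto \<open>B\<close>.
\<close>

lemma variety_eq_models_identities:
  assumes inf: "infinite (UNIV :: 'u set)" and W: "ai_variety (W :: 'u alg set)"
  shows "W = models (identities W)"
proof
  show "W \<subseteq> models (identities W)"
    using W by (auto simp: models_def identities_def ai_variety_def)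
  show "models (identities W) \<subseteq> W"
  proof
    fix B assume "B \<in> models (identities W)"
    then have B: "ai_semiring B" "\<And>s t. (s, t) \<in> identities W \<Longrightarrow> holds B s t"
      by (auto simp: models_def)
    obtain enc :: "'u trm \<times> 'u trm \<Rightarrow> 'u" where enc: "inj enc"
      using terms_embed[OF inf] .
    have "\<forall>q. \<exists>A v. q \<notin> identities W \<longrightarrow>
        A \<in> W \<and> range v \<subseteq> carrier A \<and> eval A v (fst q) \<noteq> eval A v (snd q)"
      by (auto simp: identities_def holds_def)
    then obtain A' v' where sep: "\<And>q. q \<notin> identities W \<Longrightarrow>
        A' q \<in> W \<and> range (v' q) \<subseteq> carrier (A' q)
        \<and> eval (A' q) (v' q) (fst q) \<noteq> eval (A' q) (v' q) (snd q)"
      by metis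
    define I where "I = enc ` (- identities W)"
    define A where "A i = A' (inv enc i)" for i
    define v where "v i = v' (inv enc i)" for i
    have A: "A i \<in> W" "range (v i) \<subseteq> carrier (A i)" if "i \<in> I" for i
    proof -
      obtain q where q: "q \<notin> identities W" "i = enc q"
        using \<open>i \<in> I\<close> unfolding I_def by blast
      then have "inv enc i = q"
        using enc by simp
      then show "A i \<in> W" "range (v i) \<subseteq> carrier (A i)"
        using sep[OF q(1)] by (simp_all add: A_def v_def)
    qed
    have A_closed: "closed_alg (A i)" if "i \<in> I" for i
      using A(1)[OF that] W by (auto simp: ai_variety_def ai_semiring_closed)
    let ?P = "direct_product I A"
    define tuple where "tuple t = (\<lambda>i\<in>I. eval (A i) (v i) t)" for t
    have tuple_ops: "add ?P (tuple s) (tuple t) = tuple (Plus s t)"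
      "mul ?P (tuple s) (tuple t) = tuple (Times s t)" for s t
      by (auto simp: direct_product_def tuple_def)
    define C where "C = ?P\<lparr>carrier := range tuple\<rparr>"
    have C: "subalgebra C ?P"
      using eval_in_carrier[OF A_closed A(2)] tuple_ops
      by (auto simp: subalgebra_def C_def) (auto simp: tuple_def direct_product_def)
    \<comment> \<open>Terms outside the identities of \<open>W\<close> differ in the coordinate chosen for them.\<close>
    have kernel: "(s, t) \<in> identities W" if "tuple s = tuple t" for s t
    proof (rule ccontr)
      assume not: "(s, t) \<notin> identities W"
      then have "enc (s, t) \<in> I"
        by (auto simp: I_def)
      then have "eval (A' (s, t)) (v' (s, t)) s = eval (A' (s, t)) (v' (s, t)) t"
        using fun_cong[OF that, of "enc (s, t)"] enc by (simp add: tuple_def A_def v_def)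
      then show False
        using sep[OF not] by simp
    qed
    obtain b0 where b0: "b0 \<in> carrier B"
      using B(1) by (auto simp: ai_semiring_def)
    define w where "w x = (if x \<in> carrier B then x else b0)" for x
    have w: "range w \<subseteq> carrier B"
      using b0 by (auto simp: w_def)
    define h where "h c = eval B w (SOME t. c = tuple t)" for c
    have h: "h (tuple t) = eval B w t" for t
    proof -
      have "tuple t = tuple (SOME s. tuple t = tuple s)"
        by (rule someI) simp
      then have "holds B t (SOME s. tuple t = tuple s)"
        using B(2) kernel by blast
      then show ?thesis
        using w by (simp add: h_def holds_def)
    qed
    have "carrier B \<subseteq> h ` carrier C"
    proof
      fix x assume "x \<in> carrier B"
      then have "x = h (tuple (Var x))"
        by (simp add: h w_def)
      then show "x \<in> h ` carrier C"
        by (auto simp: C_def)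
    qed
    moreover have "alg_hom h C B"
      using tuple_ops eval_in_carrier[OF ai_semiring_closed[OF B(1)] w]
      by (auto simp: alg_hom_def C_def h)
    ultimately have "hom_image B C"
      by (auto simp: hom_image_def alg_hom_def)
    then show "B \<in> W"
      using W C A(1) unfolding ai_variety_def by blast
  qed
qed

lemma finite_alg_copy:
  assumes "infinite (UNIV :: 'u set)" "finite (carrier S)"
  obtains B :: "'u alg" where "alg_iso S B"
proof -
  obtain f :: "'a \<Rightarrow> 'u" where f: "inj_on f (carrier S)"
    using assms by (metis finite_imageD infinite_arbitrarily_large inj_on_iff_card_le
        card_le_inj order_refl finite_subset subset_UNIV)
  define g where "g = the_inv_into (carrier S) f"
  have g: "g (f x) = x" if "x \<in> carrier S" for x
    using the_inv_into_f_f[OF f that] by (simp add: g_def)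
  let ?B = "\<lparr>carrier = f ` carrier S, add = \<lambda>x y. f (add S (g x) (g y)),
    mul = \<lambda>x y. f (mul S (g x) (g y))\<rparr>"
  have "alg_hom f S ?B"
    by (simp add: alg_hom_def g)
  then have "alg_iso S ?B"
    using f by (auto simp: alg_iso_def bij_betw_def)
  then show thesis
    by (rule that)
qed

lemma variety_of_eq_models:
  assumes inf: "infinite (UNIV :: 'u set)" and S: "ai_semiring S" "finite (carrier S)"
  shows "(variety_of S :: 'u alg set) = models {(s, t). holds S s t}"
proof
  let ?M = "models {(s, t). holds S s t} :: 'u alg set"
  have transfer: "holds S s t \<longleftrightarrow> holds B s t" if "alg_iso S B" for s t :: "'u trm" and B :: "'u alg"
    using iso_holds_iff[OF that ai_semiring_closed[OF S(1)]] .
  obtain B :: "'u alg" where B: "alg_iso S B"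
    using finite_alg_copy[OF inf S(2)] .
  have "B \<in> ?M"
    using transfer[OF B] iso_ai_semiring[OF B S(1)] by (auto simp: models_def)
  then show "variety_of S \<subseteq> ?M"
    using B models_variety unfolding variety_of_def by blast
  show "?M \<subseteq> variety_of S"
    unfolding variety_of_def
  proof (rule Inter_greatest)
    fix K :: "'u alg set" assume "K \<in> {K. ai_variety K \<and> (\<exists>B\<in>K. alg_iso S B)}"
    then obtain D where K: "ai_variety K" and D: "D \<in> K" "alg_iso S D"
      by blast
    have "identities K \<subseteq> {(s, t). holds S s t}"
      using D transfer by (auto simp: identities_def)
    then have "?M \<subseteq> models (identities K)"
      by (auto simp: models_def)
    then show "?M \<subseteq> K"
      using variety_eq_models_identities[OF inf K] by simp
  qed
qed


section \<open>Words of a term in a nil ai-semiring\<close>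

text \<open>
  Laws that \<open>SR6\<close> passes on to all ai-semirings in its variety.  In the order of the additive
  semilattice \<open>\<zero>\<close> is the greatest element, and by the last law it is the only common upper bound of
  an element and a multiple of it.
\<close>

locale nil_ai_semiring =
  fixes B :: "'a alg" and zero :: 'a  (\<open>\<zero>\<close>)
  assumes ai: "ai_semiring B"
    and zero_closed [simp]: "\<zero> \<in> carrier B"
    and mul_commute: "\<lbrakk>x \<in> carrier B; y \<in> carrier B\<rbrakk> \<Longrightarrow> mul B x y = mul B y x"
    and mul_self: "x \<in> carrier B \<Longrightarrow> mul B x x = \<zero>"
    and mul_mul: "\<lbrakk>x \<in> carrier B; y \<in> carrier B; z \<in> carrier B\<rbrakk> \<Longrightarrow> mul B (mul B x y) z = \<zero>"
    and add_zero: "x \<in> carrier B \<Longrightarrow> add B x \<zero> = \<zero>"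
    and add_multiple: "\<lbrakk>x \<in> carrier B; y \<in> carrier B\<rbrakk> \<Longrightarrow> add B x (mul B x y) = \<zero>"
begin

abbreviation plus (infixl \<open>\<oplus>\<close> 65) where "x \<oplus> y \<equiv> add B x y"
abbreviation times (infixl \<open>\<otimes>\<close> 70) where "x \<otimes> y \<equiv> mul B x y"

definition le (infix \<open>\<sqsubseteq>\<close> 50) where "x \<sqsubseteq> y \<longleftrightarrow> x \<oplus> y = y"

lemma plus_closed [simp]: "\<lbrakk>x \<in> carrier B; y \<in> carrier B\<rbrakk> \<Longrightarrow> x \<oplus> y \<in> carrier B"
  and times_closed [simp]: "\<lbrakk>x \<in> carrier B; y \<in> carrier B\<rbrakk> \<Longrightarrow> x \<otimes> y \<in> carrier B"
  and plus_idem [simp]: "x \<in> carrier B \<Longrightarrow> x \<oplus> x = x"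
  and plus_commute: "\<lbrakk>x \<in> carrier B; y \<in> carrier B\<rbrakk> \<Longrightarrow> x \<oplus> y = y \<oplus> x"
  using ai unfolding ai_semiring_def by blast+

lemma plus_assoc:
    "\<lbrakk>x \<in> carrier B; y \<in> carrier B; z \<in> carrier B\<rbrakk> \<Longrightarrow> (x \<oplus> y) \<oplus> z = x \<oplus> (y \<oplus> z)"
  and distrib_left:
    "\<lbrakk>x \<in> carrier B; y \<in> carrier B; z \<in> carrier B\<rbrakk> \<Longrightarrow> x \<otimes> (y \<oplus> z) = x \<otimes> y \<oplus> x \<otimes> z"
  and distrib_right:
    "\<lbrakk>x \<in> carrier B; y \<in> carrier B; z \<in> carrier B\<rbrakk> \<Longrightarrow> (x \<oplus> y) \<otimes> z = x \<otimes> z \<oplus> y \<otimes> z"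
  using ai unfolding ai_semiring_def by blast+

lemma eval_closed [simp]: "range v \<subseteq> carrier B \<Longrightarrow> eval B v t \<in> carrier B"
  using eval_in_carrier ai_semiring_closed ai by blast

lemma le_refl [simp]: "x \<in> carrier B \<Longrightarrow> x \<sqsubseteq> x"
  by (simp add: le_def)

lemma le_antisym: "\<lbrakk>x \<in> carrier B; y \<in> carrier B; x \<sqsubseteq> y; y \<sqsubseteq> x\<rbrakk> \<Longrightarrow> x = y"
  using plus_commute by (simp add: le_def)

lemma plus_le_iff:
  assumes "x \<in> carrier B" "y \<in> carrier B" "z \<in> carrier B"
  shows "x \<oplus> y \<sqsubseteq> z \<longleftrightarrow> x \<sqsubseteq> z \<and> y \<sqsubseteq> z"
  unfolding le_def
  using assms by (metis plus_assoc plus_commute plus_closed plus_idem)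

lemma le_zero [simp]: "x \<in> carrier B \<Longrightarrow> x \<sqsubseteq> \<zero>"
  by (simp add: le_def add_zero)

lemma zero_le_iff [simp]: "x \<in> carrier B \<Longrightarrow> \<zero> \<sqsubseteq> x \<longleftrightarrow> x = \<zero>"
  using le_antisym[of x \<zero>] by auto

lemma le_trans:
  assumes "x \<in> carrier B" "y \<in> carrier B" "z \<in> carrier B" "x \<sqsubseteq> y" "y \<sqsubseteq> z"
  shows "x \<sqsubseteq> z"
  using plus_le_iff[of x y z] assms by (simp add: le_def)

lemma zero_times [simp]: "x \<in> carrier B \<Longrightarrow> \<zero> \<otimes> x = \<zero>"
  and times_zero [simp]: "x \<in> carrier B \<Longrightarrow> x \<otimes> \<zero> = \<zero>"
  using mul_mul[of \<zero> \<zero> x] mul_self[of \<zero>] mul_commute[of x \<zero>] by auto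

lemma le_and_multiple_le:
  assumes "x \<in> carrier B" "y \<in> carrier B" "z \<in> carrier B" "x \<sqsubseteq> z" "x \<otimes> y \<sqsubseteq> z"
  shows "z = \<zero>"
  using plus_le_iff[of x "x \<otimes> y" z] add_multiple assms by simp

end

text \<open>
  Up to the laws of a nil ai-semiring, a term is the sum of its words.  A word is a letter, a
  product of two letters (an edge, which is a loop for a square), or has at least three letters
  and then the value \<open>\<zero>\<close>.  Edges are stored in both directions.
\<close>

primrec letters :: "'v trm \<Rightarrow> 'v set" where
  "letters (Var x) = {x}"
| "letters (Plus s t) = letters s \<union> letters t"
| "letters (Times s t) = {}"

primrec edges :: "'v trm \<Rightarrow> ('v \<times> 'v) set" where
  "edges (Var x) = {}"
| "edges (Plus s t) = edges s \<union> edges t"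
| "edges (Times s t) = letters s \<times> letters t \<union> letters t \<times> letters s"

primrec has_long_word :: "'v trm \<Rightarrow> bool" where
  "has_long_word (Var x) = False"
| "has_long_word (Plus s t) = (has_long_word s \<or> has_long_word t)"
| "has_long_word (Times s t) =
     (edges s \<noteq> {} \<or> edges t \<noteq> {} \<or> has_long_word s \<or> has_long_word t)"

lemma edges_sym: "(x, y) \<in> edges t \<Longrightarrow> (y, x) \<in> edges t"
  by (induction t) auto

lemma term_has_word: "letters t \<noteq> {} \<or> edges t \<noteq> {} \<or> has_long_word t"
  by (induction t) auto

context nil_ai_semiring
begin

text \<open>
  The first of two steps towards the description of the upper bounds of a term: a product with a
  further factor depends on the letters alone, as a factor with at least two letters makes it zero.
\<close>

lemma eval_times_le_iff:
  assumes "range v \<subseteq> carrier B" "a \<in> carrier B" "z \<in> carrier B"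
  shows "eval B v t \<otimes> a \<sqsubseteq> z \<longleftrightarrow>
    (\<forall>x\<in>letters t. v x \<otimes> a \<sqsubseteq> z) \<and> (edges t \<noteq> {} \<or> has_long_word t \<longrightarrow> z = \<zero>)"
proof (induction t)
  case (Var x)
  then show ?case by simp
next
  case (Plus s t)
  then show ?case
    using assms by (auto simp: distrib_right plus_le_iff)
next
  case (Times s t)
  then show ?case
    using assms term_has_word[of s] term_has_word[of t] by (auto simp: mul_mul)
qed

text \<open>
  The value of a term is the least upper bound of the values of its words.  Speaking of upper bounds
  avoids sums over finite sets without a neutral element.
\<close>

lemma eval_le_iff:
  assumes v: "range v \<subseteq> carrier B" and z: "z \<in> carrier B"
  shows "eval B v t \<sqsubseteq> z \<longleftrightarrow>
    (\<forall>x\<in>letters t. v x \<sqsubseteq> z) \<and> (\<forall>(x, y)\<in>edges t. v x \<otimes> v y \<sqsubseteq> z) \<and>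
    (has_long_word t \<longrightarrow> z = \<zero>)"
proof (induction t)
  case (Var x)
  then show ?case by simp
next
  case (Plus s t)
  then show ?case
    using assms by (auto simp: plus_le_iff)
next
  case (Times s t)
  have vx [simp]: "v x \<in> carrier B" for x
    using v by auto
  have "v x \<otimes> eval B v t \<sqsubseteq> z \<longleftrightarrow>
      (\<forall>y\<in>letters t. v x \<otimes> v y \<sqsubseteq> z) \<and> (edges t \<noteq> {} \<or> has_long_word t \<longrightarrow> z = \<zero>)" for x
    using eval_times_le_iff[OF v vx[of x] z, of t] mul_commute[of "v x"] v by simp
  then have "eval B v s \<otimes> eval B v t \<sqsubseteq> z \<longleftrightarrow>
      (\<forall>x\<in>letters s. \<forall>y\<in>letters t. v x \<otimes> v y \<sqsubseteq> z)
      \<and> (letters s \<noteq> {} \<and> (edges t \<noteq> {} \<or> has_long_word t) \<longrightarrow> z = \<zero>)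
      \<and> (edges s \<noteq> {} \<or> has_long_word s \<longrightarrow> z = \<zero>)"
    using eval_times_le_iff[OF v eval_closed[OF v] z, of s t] by auto
  moreover have "(\<forall>(x, y)\<in>edges (Times s t). v x \<otimes> v y \<sqsubseteq> z) \<longleftrightarrow>
      (\<forall>x\<in>letters s. \<forall>y\<in>letters t. v x \<otimes> v y \<sqsubseteq> z)"
    using mul_commute[OF vx vx] by (simp add: ball_Un split_paired_Ball_Sigma) metis
  moreover have "v x \<otimes> v y \<sqsubseteq> z" if "z = \<zero>" for x y
    using that by simp
  ultimately show ?case
    using term_has_word[of s] by auto
qed

lemma eval_eqI:
  assumes v: "range v \<subseteq> carrier B"
    and "\<And>z. z \<in> carrier B \<Longrightarrow> eval B v s \<sqsubseteq> z \<longleftrightarrow> eval B v t \<sqsubseteq> z"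
  shows "eval B v s = eval B v t"
  using assms(2)[of "eval B v s"] assms(2)[of "eval B v t"] v le_antisym by simp

end

section \<open>The ai-semiring SR6\<close>

lemma carrier_SR6 [simp]: "carrier SR6 = {1, 2, 3, 4, 5, 6}"
  by (auto simp: SR6_def)

lemma add_SR6:
  "add SR6 i j = (if i = j then i else if i = 2 \<and> j = 5 \<or> i = 5 \<and> j = 2 then 2
     else if i = 4 \<and> j = 6 \<or> i = 6 \<and> j = 4 then 4 else 1)"
  by (simp add: SR6_def doubleton_eq_iff)

lemma mul_SR6:
  "mul SR6 i j = (if i = 2 \<and> j = 6 \<or> i = 6 \<and> j = 2 \<or> i = 4 \<and> j = 5 \<or> i = 5 \<and> j = 4
     \<or> i = 5 \<and> j = 6 \<or> i = 6 \<and> j = 5 then 3 else 1)"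
  by (auto simp add: SR6_def doubleton_eq_iff)

lemma ai_semiring_SR6: "ai_semiring SR6"
  unfolding ai_semiring_def by (simp add: add_SR6 mul_SR6)

interpretation SR6: nil_ai_semiring SR6 1
  by unfold_locales (auto simp: ai_semiring_SR6 add_SR6 mul_SR6)

lemma SR6_le_3 [simp]: "SR6.le x 3 \<longleftrightarrow> x = 3"
  by (auto simp: SR6.le_def add_SR6)

text \<open>
  This is \<open>SR6.eval_le_iff\<close> for the upper bound \<open>3\<close>, which is a minimal element of \<open>SR6\<close>.
\<close>

lemma eval_SR6_eq_3_iff:
  assumes "range v \<subseteq> carrier SR6"
  shows "eval SR6 v t = 3 \<longleftrightarrow>
    (\<forall>x\<in>letters t. v x = 3) \<and> (\<forall>(x, y)\<in>edges t. mul SR6 (v x) (v y) = 3) \<and> \<not> has_long_word t"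
  using SR6.eval_le_iff[of v 3 t] assms by simp

text \<open>
  Every product in \<open>SR6\<close> is \<open>1\<close> or \<open>3\<close>, and so is everything above a product.
\<close>

lemma eval_SR6_letters_only:
  assumes v: "range v \<subseteq> carrier SR6" and t: "eval SR6 v t \<notin> {1, 3}"
  shows "edges t = {}" "\<not> has_long_word t"
proof -
  let ?z = "eval SR6 v t"
  have z: "?z \<in> carrier SR6"
    using SR6.eval_closed v by blast
  have le: "SR6.le ?z ?z"
    using z by (rule SR6.le_refl)
  then show "\<not> has_long_word t"
    using SR6.eval_le_iff[OF v z, of t] t by auto
  show "edges t = {}"
  proof (rule ccontr)
    assume "edges t \<noteq> {}"
    then obtain x y where "SR6.le (mul SR6 (v x) (v y)) ?z"
      using le SR6.eval_le_iff[OF v z, of t] by fast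
    moreover have "mul SR6 (v x) (v y) \<in> {1, 3}"
      by (simp add: mul_SR6)
    ultimately show False
      using t by (auto simp: SR6.le_def add_SR6 split: if_splits)
  qed
qed

definition solutions :: "nat set \<Rightarrow> 'v trm \<Rightarrow> ('v \<Rightarrow> nat) set" where
  "solutions D t = {v. range v \<subseteq> D \<and> eval SR6 v t = 3}"

lemma solutions_iff:
  assumes "D \<subseteq> carrier SR6"
  shows "v \<in> solutions D t \<longleftrightarrow> range v \<subseteq> D \<and> (\<forall>x\<in>letters t. v x = 3) \<and>
    (\<forall>x y. (x, y) \<in> edges t \<longrightarrow> mul SR6 (v x) (v y) = 3) \<and> \<not> has_long_word t"
  using eval_SR6_eq_3_iff[of v t] assms unfolding solutions_def by fast

lemma three_mul: "mul SR6 3 n \<noteq> 3" "mul SR6 n 3 \<noteq> 3"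
  by (simp_all add: mul_SR6)

text \<open>
  Let \<open>x\<close> be a letter of \<open>s\<close>.  A solution gives it the value \<open>3\<close>, and as \<open>3\<close> annihilates everything, \<open>x\<close>
  lies on no edge of \<open>t\<close>.  If \<open>x\<close> were not a letter of \<open>t\<close> either, changing its value to \<open>1\<close> would destroy
  the solution for \<open>s\<close> but not for \<open>t\<close>.
\<close>

lemma solutions_letters:
  assumes D: "1 \<in> D" "D \<subseteq> carrier SR6"
    and v: "v \<in> solutions D s" and eq: "solutions D s = solutions D t"
  shows "letters s \<subseteq> letters t"
proof (rule subsetI, rule ccontr)
  fix x assume x: "x \<in> letters s" "x \<notin> letters t"
  have "v x = 3"
    using v x(1) D(2) by (simp add: solutions_iff)
  moreover have vt: "v \<in> solutions D t"
    using v eq by simp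
  ultimately have "(x, y) \<notin> edges t" "(y, x) \<notin> edges t" for y
    using three_mul unfolding solutions_iff[OF D(2)] by metis+
  then have "v(x := 1) \<in> solutions D t"
    using vt x(2) D unfolding solutions_iff[OF D(2)] by (auto split: if_splits)
  moreover have "v(x := 1) \<notin> solutions D s"
    using x(1) D(2) by (auto simp: solutions_iff)
  ultimately show False
    using eq by simp
qed

definition SR6_on :: "nat set \<Rightarrow> nat alg" where
  "SR6_on D = SR6\<lparr>carrier := D\<rparr>"

lemma SR6_on_simps [simp]: "carrier (SR6_on D) = D"
    "add (SR6_on D) = add SR6" "mul (SR6_on D) = mul SR6"
  by (simp_all add: SR6_on_def)

lemma eval_SR6_on [simp]: "eval (SR6_on D) v t = eval SR6 v t"
  by (rule eval_cong_operations) simp_all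

lemma SR6_on_carrier: "SR6_on (carrier SR6) = SR6"
  by (simp add: SR6_on_def)

text \<open>
  Values other than \<open>1\<close> and \<open>3\<close> are taken only by sums of letters, and such a sum has the solution that is
  constantly \<open>3\<close>.  If the other side has it too, it is also a sum of letters, and then of the same
  letters.
\<close>

lemma equal_solutions_imp_identity:
  fixes s t :: "'v trm"
  assumes D: "{1, 3} \<subseteq> D" "D \<subseteq> carrier SR6" and eq: "solutions D s = solutions D t"
  shows "holds (SR6_on D) s t"
proof -
  have letters_only: "eval SR6 v p = eval SR6 v q"
    if eq: "solutions D p = solutions D q" and v: "range v \<subseteq> D" and p: "eval SR6 v p \<notin> {1, 3}"
    for p q :: "'v trm" and v
  proof -
    have v6: "range v \<subseteq> carrier SR6"
      using v D by blast
    have "(\<lambda>_. 3) \<in> solutions D p"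
      using eval_SR6_letters_only[OF v6 p] D by (simp add: solutions_iff)
    then have three: "(\<lambda>_. 3) \<in> solutions D p" "(\<lambda>_. 3) \<in> solutions D q"
      using eq by auto
    then have "letters p = letters q"
      using solutions_letters[OF _ D(2) three(1) eq] solutions_letters[OF _ D(2) three(2) eq[symmetric]]
        D(1) by blast
    moreover have "edges p = {}" "edges q = {}" "\<not> has_long_word p" "\<not> has_long_word q"
      using three D(2) by (auto simp: solutions_iff mul_SR6)
    ultimately show ?thesis
      by (intro SR6.eval_eqI[OF v6]) (simp only: SR6.eval_le_iff[OF v6])
  qed
  show ?thesis
    unfolding holds_def eval_SR6_on SR6_on_simps
  proof (intro allI impI)
    fix v :: "'v \<Rightarrow> nat" assume v: "range v \<subseteq> D"
    have "eval SR6 v s = 3 \<longleftrightarrow> eval SR6 v t = 3"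
      using eq v unfolding solutions_def by blast
    then show "eval SR6 v s = eval SR6 v t"
      using letters_only[OF eq v] letters_only[OF eq[symmetric] v] by force
  qed
qed

lemma identity_imp_equal_solutions:
  "holds (SR6_on D) s t \<Longrightarrow> solutions D s = solutions D t"
  by (auto simp: holds_def solutions_def)

lemma failing_identity_separated:
  fixes s t :: "'v trm"
  assumes D: "{1, 3} \<subseteq> D" "D \<subseteq> carrier SR6" and "\<not> holds (SR6_on D) s t"
    and B: "holds B s t"
  obtains s' t' :: "'v trm" and v where "holds B s' t'" "range v \<subseteq> D" "eval SR6 v s' = 3" "eval SR6 v t' \<noteq> 3"
proof -
  have ts: "holds B t s"
    using B by (simp add: holds_def)
  have "solutions D s \<noteq> solutions D t"
    using equal_solutions_imp_identity[OF D] assms(3) by blast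
  then consider v where "v \<in> solutions D s" "v \<notin> solutions D t"
    | v where "v \<in> solutions D t" "v \<notin> solutions D s"
    by blast
  then show thesis
  proof cases
    case 1
    then show thesis
      by (intro that[OF B, of v]) (simp_all add: solutions_def)
  next
    case 2
    then show thesis
      by (intro that[OF ts, of v]) (simp_all add: solutions_def)
  qed
qed

section \<open>Consequences of an identity that fails in a subalgebra of SR6\<close>

context nil_ai_semiring
begin

text \<open>
  The substitution \<open>f\<close> sends the elements of \<open>SR6\<close> to elements of \<open>B\<close>, respecting \<open>5 \<le> 2\<close> and \<open>6 \<le> 4\<close>, so
  that products equal to \<open>3\<close> land below \<open>q\<close>.  Thus the side with value \<open>3\<close> stays below \<open>q\<close>, and so does
  the other side, by the identity.  The latter has a word whose value is not \<open>3\<close>; unless this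
  word is an edge between \<open>2\<close> and \<open>4\<close>, its image below \<open>q\<close> forces \<open>q = \<zero>\<close>.
\<close>

lemma separated_identity_imp_multiple:
  assumes st: "holds B s t"
    and v: "range v \<subseteq> carrier SR6" "eval SR6 v s = 3" "eval SR6 v t \<noteq> 3"
    and [simp]: "x1 \<in> carrier B" "x2 \<in> carrier B" "y1 \<in> carrier B" "y2 \<in> carrier B"
  defines "q \<equiv> x1 \<otimes> y1 \<oplus> x2 \<otimes> y1 \<oplus> x2 \<otimes> y2"
  shows "q = \<zero> \<or> x1 \<otimes> y2 \<sqsubseteq> q \<and> 2 \<in> range v"
proof -
  have q [simp]: "q \<in> carrier B"
    by (simp add: q_def)
  have below: "x1 \<otimes> y1 \<sqsubseteq> q" "x2 \<otimes> y1 \<sqsubseteq> q" "x2 \<otimes> y2 \<sqsubseteq> q"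
    using plus_le_iff[of "x1 \<otimes> y1 \<oplus> x2 \<otimes> y1" "x2 \<otimes> y2" q]
      plus_le_iff[of "x1 \<otimes> y1" "x2 \<otimes> y1" q] by (simp_all add: q_def)
  have q_times [simp]: "q \<otimes> x = \<zero>" "x \<otimes> q = \<zero>" if "x \<in> carrier B" for x
    using that mul_commute[of x q] by (simp_all add: q_def distrib_right mul_mul)
  define f :: "nat \<Rightarrow> 'a" where "f n = (if n = 2 then x1 \<oplus> x2 else if n = 5 then x2
    else if n = 4 then y1 \<oplus> y2 else if n = 6 then y1 else if n = 3 then q else \<zero>)" for n
  have f_closed [simp]: "f n \<in> carrier B" for n
    by (simp add: f_def)
  have f3: "f 3 = q"
    by (simp add: f_def)
  have f: "range (f \<circ> v) \<subseteq> carrier B"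
    by auto
  have vx: "v x \<in> {1, 2, 3, 4, 5, 6}" for x
    using v(1) by auto
  have "f i \<otimes> f j \<sqsubseteq> q" if "mul SR6 i j = 3" for i j
    using that below mul_commute[of y1 x1] mul_commute[of y1 x2] mul_commute[of y2 x2]
    by (auto simp: mul_SR6 f_def distrib_left distrib_right plus_le_iff split: if_splits)
  then have "eval B (f \<circ> v) s \<sqsubseteq> q"
    using v(1,2) eval_SR6_eq_3_iff[of v s] f3 by (auto simp: eval_le_iff[OF f])
  then have t: "eval B (f \<circ> v) t \<sqsubseteq> q"
    using st f by (simp add: holds_def)
  have letter: "q = \<zero>" if x: "x \<in> letters t" "v x \<noteq> 3" for x
  proof -
    have le: "f (v x) \<sqsubseteq> q"
      using t x(1) by (simp add: eval_le_iff[OF f])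
    have "\<exists>w\<in>{x2, y1}. w \<sqsubseteq> q" if "v x \<noteq> 1"
      using le vx[of x] x(2) that by (auto simp: f_def plus_le_iff split: if_splits)
    moreover have "q = \<zero>" if "x2 \<sqsubseteq> q"
      using le_and_multiple_le[of x2 y1 q] that below by simp
    moreover have "q = \<zero>" if "y1 \<sqsubseteq> q"
      using le_and_multiple_le[of y1 x2 q] that below mul_commute[of y1 x2] by simp
    moreover have "q = \<zero>" if "v x = 1"
      using le that by (simp add: f_def)
    ultimately show ?thesis
      by blast
  qed
  have edge: "q = \<zero> \<or> x1 \<otimes> y2 \<sqsubseteq> q \<and> 2 \<in> range v"
    if xy: "(x, y) \<in> edges t" "mul SR6 (v x) (v y) \<noteq> 3" for x y
  proof -
    have le: "f (v x) \<otimes> f (v y) \<sqsubseteq> q"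
      using t xy(1) by (auto simp: eval_le_iff[OF f])
    have square: "q = \<zero>" if "w \<in> carrier B" "w \<otimes> w \<sqsubseteq> q" for w
      using that by (simp add: mul_self)
    \<comment> \<open>Products within \<open>{2, 5}\<close> or within \<open>{4, 6}\<close> lie above the squares of \<open>x2\<close> or \<open>y1\<close>, which are \<open>\<zero>\<close>.\<close>
    consider "{v x, v y} \<inter> {1, 3} \<noteq> {}" | "{v x, v y} \<subseteq> {2, 5}" | "{v x, v y} \<subseteq> {4, 6}"
      | "v x = 2" "v y = 4" | "v x = 4" "v y = 2"
      using vx[of x] vx[of y] xy(2) by (auto simp: mul_SR6)
    then show ?thesis
    proof cases
      case 1
      then show ?thesis
        using le by (auto simp: f_def)
    next
      case 2
      then have "x2 \<otimes> x2 \<sqsubseteq> q"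
        using le by (auto simp: f_def distrib_left distrib_right plus_le_iff)
      then show ?thesis
        using square[of x2] square[of y1] by simp
    next
      case 3
      then have "y1 \<otimes> y1 \<sqsubseteq> q"
        using le by (auto simp: f_def distrib_left distrib_right plus_le_iff)
      then show ?thesis
        using square[of x2] square[of y1] by simp
    next
      case 4
      then have "x1 \<otimes> y2 \<sqsubseteq> q"
        using le by (auto simp: f_def distrib_left distrib_right plus_le_iff)
      then show ?thesis
        using 4 by (metis rangeI)
    next
      case 5
      then have "x1 \<otimes> y2 \<sqsubseteq> q"
        using le mul_commute[of y2 x1] by (auto simp: f_def distrib_left distrib_right plus_le_iff)
      then show ?thesis
        using 5 by (metis rangeI)
    qed
  qed
  have "q = \<zero>" if "has_long_word t"
    using t that by (simp add: eval_le_iff[OF f])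
  then show ?thesis
    using letter edge v(1,3) eval_SR6_eq_3_iff[of v t] by blast
qed

text \<open>
  The product of the ends of the path \<open>x1 y1 x2 y2\<close> lies below the sum of its three edges.
\<close>

definition path_law :: bool where
  "path_law \<longleftrightarrow> (\<forall>x1\<in>carrier B. \<forall>x2\<in>carrier B. \<forall>y1\<in>carrier B. \<forall>y2\<in>carrier B.
     x1 \<otimes> y2 \<sqsubseteq> x1 \<otimes> y1 \<oplus> x2 \<otimes> y1 \<oplus> x2 \<otimes> y2)"

lemma path_law_if_identity_fails:
  fixes s t :: "'v trm"
  assumes st: "holds B s t" and fails: "\<not> holds SR6 s t"
  shows path_law
proof -
  have sub: "{1, 3} \<subseteq> carrier SR6" and fails': "\<not> holds (SR6_on (carrier SR6)) s t"
    using fails by (simp, simp only: SR6_on_carrier not_False_eq_True)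
  obtain s' t' :: "'v trm" and v where *: "holds B s' t'" "range v \<subseteq> carrier SR6"
      "eval SR6 v s' = 3" "eval SR6 v t' \<noteq> 3"
    using failing_identity_separated[OF sub order_refl fails' st] .
  show ?thesis
    unfolding path_law_def
  proof (intro ballI)
    fix x1 x2 y1 y2
    assume closed: "x1 \<in> carrier B" "x2 \<in> carrier B" "y1 \<in> carrier B" "y2 \<in> carrier B"
    then have "x1 \<otimes> y2 \<sqsubseteq> \<zero>"
      by simp
    then show "x1 \<otimes> y2 \<sqsubseteq> x1 \<otimes> y1 \<oplus> x2 \<otimes> y1 \<oplus> x2 \<otimes> y2"
      using separated_identity_imp_multiple[OF * closed] by metis
  qed
qed

lemma product_zero_if_identity_fails:
  fixes s t :: "'v trm"
  assumes st: "holds B s t" and fails: "\<not> holds (SR6_on {1, 3, 5, 6}) s t"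
    and xy: "x \<in> carrier B" "y \<in> carrier B"
  shows "x \<otimes> y = \<zero>"
proof -
  obtain s' t' :: "'v trm" and v where *: "holds B s' t'" "range v \<subseteq> {1, 3, 5, 6}"
      "eval SR6 v s' = 3" "eval SR6 v t' \<noteq> 3"
    using failing_identity_separated[OF _ _ fails st] by auto
  have "range v \<subseteq> carrier SR6" "2 \<notin> range v"
    using *(2) by auto
  then show ?thesis
    \<comment> \<open>For \<open>x1 = x2\<close> and \<open>y1 = y2\<close> the element \<open>q\<close> is the product itself.\<close>
    using separated_identity_imp_multiple[OF *(1) _ *(3,4), of x x y y] xy by simp
qed

lemma trivial_if_identity_fails:
  fixes s t :: "'v trm"
  assumes st: "holds B s t" and fails: "\<not> holds (SR6_on {1, 3}) s t"
    and x: "x \<in> carrier B"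
  shows "x = \<zero>"
proof -
  obtain s' t' :: "'v trm" and v where *: "holds B s' t'" "range v \<subseteq> {1, 3}"
      "eval SR6 v s' = 3" "eval SR6 v t' \<noteq> 3"
    using failing_identity_separated[OF _ _ fails st] by auto
  have v: "range v \<subseteq> carrier SR6" "\<And>a. v a = 1 \<or> v a = 3"
    using *(2) by auto
  define f where "f n = (if n = 3 then x else \<zero>)" for n :: nat
  have f: "range (f \<circ> v) \<subseteq> carrier B"
    using x by (auto simp: f_def)
  have product: "f i \<otimes> f j = \<zero>" for i j
    using x by (simp add: f_def mul_self)
  have no_edge: "mul SR6 (v a) (v b) \<noteq> 3" for a b
    using v(2)[of a] v(2)[of b] by (auto simp: mul_SR6)
  have "eval B (f \<circ> v) s' \<sqsubseteq> x"
    using *(3) no_edge x v(1) by (auto simp: eval_SR6_eq_3_iff eval_le_iff[OF f] f_def)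
  then have le: "eval B (f \<circ> v) t' \<sqsubseteq> x"
    using *(1) f by (simp add: holds_def)
  consider a where "a \<in> letters t'" "v a = 1" | "edges t' \<noteq> {}" | "has_long_word t'"
    using *(4) v eval_SR6_eq_3_iff[OF v(1), of t'] by fastforce
  then show ?thesis
  proof cases
    case 1
    then show ?thesis
      using le x by (auto simp: eval_le_iff[OF f] f_def)
  next
    case 2
    then show ?thesis
      using le x product by (fastforce simp: eval_le_iff[OF f])
  next
    case 3
    then show ?thesis
      using le x by (simp add: eval_le_iff[OF f])
  qed
qed

end

section \<open>Bases of identities relative to SR6\<close>

lemma three_edges:
  assumes "(x, y) \<in> edges t" "v \<in> solutions D t" "D \<subseteq> carrier SR6"
  shows "mul SR6 (v x) (v y) = 3"
  using assms by (simp add: solutions_iff[OF assms(3)])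

text \<open>
  Replacing the values \<open>2\<close> and \<open>4\<close> by the smaller \<open>5\<close> and \<open>6\<close> keeps every product equal to \<open>3\<close>, so a term
  without solutions in \<open>{1, 3, 5, 6}\<close> has none in \<open>SR6\<close>.
\<close>

lemma no_solutions_imp_identity:
  assumes "solutions {1, 3, 5, 6} t = {}" and v: "range v \<subseteq> carrier SR6"
  shows "eval SR6 v t = 1"
proof (rule ccontr)
  assume *: "eval SR6 v t \<noteq> 1"
  have D: "{1, 3, 5, 6} \<subseteq> carrier SR6"
    by simp
  show False
  proof (cases "eval SR6 v t = 3")
    case True
    define \<pi> :: "nat \<Rightarrow> nat" where "\<pi> n = (if n = 2 then 5 else if n = 4 then 6 else n)" for n
    have "mul SR6 (\<pi> i) (\<pi> j) = 3" if "mul SR6 i j = 3" for i j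
      using that by (auto simp: mul_SR6 \<pi>_def split: if_splits)
    moreover have "range (\<pi> \<circ> v) \<subseteq> {1, 3, 5, 6}"
      using v by (auto simp: \<pi>_def)
    moreover have "\<pi> 3 = 3"
      by (simp add: \<pi>_def)
    ultimately have "\<pi> \<circ> v \<in> solutions {1, 3, 5, 6} t"
      using True eval_SR6_eq_3_iff[OF v, of t] unfolding solutions_iff[OF D] by auto
    then show False
      using assms(1) by simp
  next
    case False
    then have "(\<lambda>_. 3) \<in> solutions {1, 3, 5, 6} t"
      using eval_SR6_letters_only[OF v, of t] * unfolding solutions_iff[OF D] by simp
    then show False
      using assms(1) by simp
  qed
qed

text \<open>
  A solution in \<open>{1, 3, 5, 6}\<close> colours the edges properly with \<open>5\<close> and \<open>6\<close>.  If \<open>x\<close> and \<open>y\<close> were in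
  different components of the graph of \<open>s\<close>, exchanging the colours in the component of \<open>y\<close> would give
  another solution for \<open>s\<close>, but not for \<open>t\<close>.  So they are joined by a walk, whose length is odd as their colours
  differ.
\<close>

lemma edge_joined_by_odd_walk:
  fixes s t :: "'v trm"
  defines "E \<equiv> edges s"
  assumes v: "v \<in> solutions {1, 3, 5, 6} s"
    and eq: "solutions {1, 3, 5, 6} s = solutions {1, 3, 5, 6} t"
    and xy: "(x, y) \<in> edges t"
  shows "(x, y) \<in> (E O E)\<^sup>* O E"
proof -
  let ?D = "{1, 3, 5, 6} :: nat set"
  have D: "?D \<subseteq> carrier SR6"
    by simp
  have symE: "sym E"
    unfolding E_def by (auto intro: symI edges_sym)
  have vD: "v a \<in> ?D" for a
    using v by (auto simp: solutions_def)
  have vx: "mul SR6 (v x) (v y) = 3"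
    using three_edges[OF xy _ D] v eq by blast
  have colours: "mul SR6 i j = 3 \<longleftrightarrow> i = 5 \<and> j = 6 \<or> i = 6 \<and> j = 5"
    if "i \<in> ?D" "j \<in> ?D" for i j
    using that by (auto simp: mul_SR6)
  define flip :: "nat \<Rightarrow> nat" where "flip n = (if n = 5 then 6 else if n = 6 then 5 else n)" for n
  have flip: "flip n \<in> ?D" if "n \<in> ?D" for n
    using that by (auto simp: flip_def)
  define w where "w a = (if (y, a) \<in> E\<^sup>* then flip (v a) else v a)" for a
  have wD: "range w \<subseteq> ?D"
    using vD flip by (auto simp: w_def)
  have "w \<in> solutions ?D s"
    unfolding solutions_iff[OF D]
  proof (intro conjI allI impI ballI)
    fix a assume "a \<in> letters s"
    then show "w a = 3"
      using v unfolding solutions_iff[OF D] by (simp add: w_def flip_def)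
  next
    fix a b assume ab: "(a, b) \<in> edges s"
    have "(y, a) \<in> E\<^sup>* \<longleftrightarrow> (y, b) \<in> E\<^sup>*"
      using ab edges_sym[OF ab] unfolding E_def by (meson rtrancl.rtrancl_into_rtrancl)
    moreover have "mul SR6 (v a) (v b) = 3"
      using three_edges[OF ab v D] .
    ultimately show "mul SR6 (w a) (w b) = 3"
      using colours[OF vD vD, of a b] by (auto simp: w_def flip_def mul_SR6)
  next
    show "\<not> has_long_word s" "range w \<subseteq> ?D"
      using v wD unfolding solutions_iff[OF D] by blast+
  qed
  then have "mul SR6 (w x) (w y) = 3"
    using three_edges[OF xy _ D] eq by blast
  then have "(y, x) \<in> E\<^sup>*"
    using vx colours[OF vD vD, of x y] by (auto simp: w_def flip_def mul_SR6 split: if_splits)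
  then have walk: "(x, y) \<in> E\<^sup>*"
    using sym_rtrancl[OF symE] by (auto dest: symD)
  \<comment> \<open>The parity of a walk from \<open>x\<close> is read off from the colour of its end.\<close>
  have "(if v u = v x then (x, u) \<in> (E O E)\<^sup>* else (x, u) \<in> (E O E)\<^sup>* O E) \<and> v u \<in> {5, 6}"
    if "(x, u) \<in> E\<^sup>*" for u
    using that
  proof (induction rule: rtrancl_induct)
    case base
    then show ?case
      using vx colours[OF vD vD, of x y] by auto
  next
    case (step u u')
    have "v u = 5 \<and> v u' = 6 \<or> v u = 6 \<and> v u' = 5"
      using three_edges[OF step(2)[unfolded E_def] v D] colours[OF vD vD] by blast
    moreover have "v x = 5 \<or> v x = 6"
      using vx colours[OF vD vD, of x y] by auto
    moreover have "(x, u') \<in> (E O E)\<^sup>*" if odd: "(x, u) \<in> (E O E)\<^sup>* O E"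
    proof -
      obtain m where "(x, m) \<in> (E O E)\<^sup>*" "(m, u) \<in> E"
        using odd by blast
      then show ?thesis
        using step(2) by (meson relcompI rtrancl.rtrancl_into_rtrancl)
    qed
    ultimately show ?case
      using step(2,3) by (auto split: if_splits)
  qed
  from this[OF walk] show ?thesis
    using vx colours[OF vD vD, of x y] by (auto split: if_splits)
qed

context nil_ai_semiring
begin

text \<open>
  By the path law, two more edges at the end of an odd walk preserve the bound.
\<close>

lemma odd_walk_le:
  assumes law: path_law and v: "range v \<subseteq> carrier B" and z: "z \<in> carrier B"
    and E: "sym E" "\<And>a b. (a, b) \<in> E \<Longrightarrow> v a \<otimes> v b \<sqsubseteq> z"
    and xy: "(x, y) \<in> (E O E)\<^sup>* O E"
  shows "v x \<otimes> v y \<sqsubseteq> z"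
proof -
  have vx [simp]: "v a \<in> carrier B" for a
    using v by auto
  have "\<forall>y. (m, y) \<in> E \<longrightarrow> v x \<otimes> v y \<sqsubseteq> z" if "(x, m) \<in> (E O E)\<^sup>*" for m
    using that
  proof (induction rule: rtrancl_induct)
    case base
    then show ?case
      using E(2) by blast
  next
    case (step m m')
    obtain a where a: "(m, a) \<in> E" "(a, m') \<in> E"
      using step(2) by blast
    show ?case
    proof (intro allI impI)
      fix y assume y: "(m', y) \<in> E"
      have "v x \<otimes> v a \<oplus> v m' \<otimes> v a \<oplus> v m' \<otimes> v y \<sqsubseteq> z"
        using step(3) a E y by (auto simp: plus_le_iff z dest: symD)
      moreover have "v x \<otimes> v y \<sqsubseteq> v x \<otimes> v a \<oplus> v m' \<otimes> v a \<oplus> v m' \<otimes> v y"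
        using law vx unfolding path_law_def by blast
      ultimately show "v x \<otimes> v y \<sqsubseteq> z"
        using z by (meson le_trans plus_closed times_closed vx)
    qed
  qed
  then show ?thesis
    using xy by blast
qed

text \<open>
  If the sides have solutions, they have the same letters, and each edge of one side is joined by an odd
  walk in the other, so they have the same upper bounds.  Without solutions both sides are
  constantly zero in \<open>SR6\<close>, as happens for graphs with an odd cycle, and the identity holds in \<open>SR6\<close>.
\<close>

lemma path_law_imp_identity:
  fixes s t :: "'v trm"
  assumes law: path_law and SR6: "\<And>s t :: 'v trm. holds SR6 s t \<Longrightarrow> holds B s t"
    and st: "holds (SR6_on {1, 3, 5, 6}) s t"
  shows "holds B s t"
proof (cases "solutions {1, 3, 5, 6} s = {}")
  case True
  then have "holds SR6 s t"
    using no_solutions_imp_identity[of s] no_solutions_imp_identity[of t]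
      identity_imp_equal_solutions[OF st] by (simp add: holds_def)
  then show ?thesis
    by (rule SR6)
next
  case False
  let ?D = "{1, 3, 5, 6} :: nat set"
  have D: "1 \<in> ?D" "?D \<subseteq> carrier SR6"
    by simp_all
  have le: "eval B v t \<sqsubseteq> z"
    if eq: "solutions ?D s = solutions ?D t" and u: "u \<in> solutions ?D s" and "eval B v s \<sqsubseteq> z"
      and v: "range v \<subseteq> carrier B" and z: "z \<in> carrier B" for s t :: "'v trm" and u v z
  proof -
    have s: "\<forall>x\<in>letters s. v x \<sqsubseteq> z" "\<forall>(x, y)\<in>edges s. v x \<otimes> v y \<sqsubseteq> z"
      using that by (simp_all add: eval_le_iff)
    have ut: "u \<in> solutions ?D t"
      using u eq by simp
    have "\<not> has_long_word t"
      using ut unfolding solutions_iff[OF D(2)] by blast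
    moreover have "letters t \<subseteq> letters s"
      using solutions_letters[OF D ut eq[symmetric]] .
    moreover have "v x \<otimes> v y \<sqsubseteq> z" if "(x, y) \<in> edges t" for x y
      using odd_walk_le[OF law v z _ _ edge_joined_by_odd_walk[OF u eq that]] s(2) edges_sym[of _ _ s]
      by (auto simp: sym_def)
    ultimately show ?thesis
      using s(1) by (auto simp: eval_le_iff[OF v z])
  qed
  obtain u where u: "u \<in> solutions ?D s"
    using False by blast
  have eq: "solutions ?D s = solutions ?D t"
    using identity_imp_equal_solutions[OF st] .
  then have ut: "u \<in> solutions ?D t"
    using u by simp
  show ?thesis
    unfolding holds_def
    using le[OF eq u] le[OF eq[symmetric] ut] by (blast intro: eval_eqI)
qed

text \<open>
  In \<open>{1, 3}\<close> as in \<open>B\<close>, a term is constantly zero as soon as it has a word with at least two letters, and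
  the assignment that is constantly \<open>3\<close> tells whether it has one.
\<close>

lemma product_zero_imp_identity:
  fixes s t :: "'v trm"
  assumes zero: "\<And>x y. x \<in> carrier B \<Longrightarrow> y \<in> carrier B \<Longrightarrow> x \<otimes> y = \<zero>"
    and st: "holds (SR6_on {1, 3}) s t"
  shows "holds B s t"
  unfolding holds_def
proof (intro allI impI)
  fix v :: "'v \<Rightarrow> 'a" assume v: "range v \<subseteq> carrier B"
  let ?D = "{1, 3} :: nat set"
  have D: "1 \<in> ?D" "?D \<subseteq> carrier SR6"
    by simp_all
  have eq: "solutions ?D s = solutions ?D t"
    using identity_imp_equal_solutions[OF st] .
  have three: "(\<lambda>_. 3) \<in> solutions ?D p \<longleftrightarrow> edges p = {} \<and> \<not> has_long_word p" for p :: "'v trm"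
    unfolding solutions_iff[OF D(2)] by (auto simp: three_mul)
  show "eval B v s = eval B v t"
  proof (cases "(\<lambda>_. 3) \<in> solutions ?D s")
    case True
    then have True': "(\<lambda>_. 3) \<in> solutions ?D t"
      using eq by simp
    have "letters s = letters t"
      using solutions_letters[OF D True eq] solutions_letters[OF D True' eq[symmetric]] by blast
    then show ?thesis
      using True True' unfolding three by (intro eval_eqI[OF v]) (simp add: eval_le_iff[OF v])
  next
    case False
    have v_times: "v x \<otimes> v y = \<zero>" for x y
      using v by (intro zero) auto
    have "eval B v p = \<zero>" if p: "(\<lambda>_. 3) \<notin> solutions ?D p" for p :: "'v trm"
    proof -
      have closed: "eval B v p \<in> carrier B"
        using v by simp
      then show ?thesis
        using p eval_le_iff[OF v closed, of p] unfolding three by (auto simp: v_times)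
    qed
    then show ?thesis
      using False eq by simp
  qed
qed

end

section \<open>Subvarieties of the variety of SR6\<close>

lemma ai_semiring_SR6_on:
  assumes "D \<subseteq> {1, 2, 3, 4, 5, 6}" "{1, 3} \<subseteq> D" "\<And>i j. \<lbrakk>i \<in> D; j \<in> D\<rbrakk> \<Longrightarrow> add SR6 i j \<in> D"
  shows "ai_semiring (SR6_on D)"
proof -
  have "mul SR6 i j \<in> D" for i j
    using assms(2) by (simp add: mul_SR6)
  then have "subalgebra (SR6_on D) SR6"
    using assms unfolding subalgebra_def by auto
  then show ?thesis
    using subalgebra_closed subalgebra_holds ai_semiring_SR6 unfolding ai_semiring_iff_axioms by blast
qed

lemma ai_semiring_SR6_on_13: "ai_semiring (SR6_on {1, 3})"
  by (rule ai_semiring_SR6_on) (auto simp: add_SR6)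

lemma ai_semiring_SR6_on_1356: "ai_semiring (SR6_on {1, 3, 5, 6})"
  by (rule ai_semiring_SR6_on) (auto simp: add_SR6)

lemma nonempty_submultisets_pair:
  assumes "a \<noteq> b"
  shows "{u. u \<noteq> {#} \<and> u \<subseteq># {#a, b#}} = {{#a#}, {#b#}, {#a, b#}}"
proof -
  have single: "u = {#} \<or> u = {#c#}" if "u \<subseteq># {#c#}" for u :: "'a multiset" and c
    using that nonempty_subseteq_mset_eq_single[of u c] by (cases "u = {#}") simp_all
  have "u \<in> {{#a#}, {#b#}, {#a, b#}}" if u: "u \<noteq> {#}" "u \<subseteq># {#a, b#}" for u
  proof (cases "a \<in># u")
    case True
    then obtain w where w: "u = add_mset a w"
      using multi_member_split by metis
    then have "w \<subseteq># {#b#}"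
      using u(2) by simp
    then show ?thesis
      using single w by auto
  next
    case False
    have "u \<subseteq># {#b#}"
    proof (rule mset_subset_eqI)
      show "count u x \<le> count {#b#} x" for x
        using mset_subset_eq_count[OF u(2), of x] False by (cases "x = a") (auto simp: not_in_iff)
    qed
    then show ?thesis
      using single u(1) by auto
  qed
  moreover have "{#b#} \<subseteq># {#a, b#}"
    by simp
  ultimately show ?thesis
    by auto
qed

lemma Sc_single_iso: "alg_iso (SR6_on {1, 3}) (Sc {#a#})"
proof -
  let ?h = "\<lambda>n::nat. if n = 3 then Some {#a#} else None"
  have words: "{u. u \<noteq> {#} \<and> u \<subseteq># {#a#}} = {{#a#}}"
    by (auto dest: nonempty_subseteq_mset_eq_single)
  have "alg_hom ?h (SR6_on {1, 3}) (Sc {#a#})"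
    unfolding alg_hom_def Sc_def words by (auto simp: add_SR6 mul_SR6)
  moreover have "bij_betw ?h {1, 3} {None, Some {#a#}}"
    by (auto simp: bij_betw_def inj_on_def)
  ultimately show ?thesis
    unfolding alg_iso_def Sc_def words by auto
qed

lemma Sc_pair_iso:
  assumes ab: "a \<noteq> b"
  shows "alg_iso (SR6_on {1, 3, 5, 6}) (Sc {#a, b#})"
proof -
  let ?h = "\<lambda>n::nat. if n = 5 then Some {#a#} else if n = 6 then Some {#b#}
    else if n = 3 then Some {#a, b#} else None"
  note words = nonempty_submultisets_pair[OF ab]
  have carrier: "carrier (Sc {#a, b#}) = {None, Some {#a#}, Some {#b#}, Some {#a, b#}}"
    by (simp add: Sc_def words)
  have "alg_hom ?h (SR6_on {1, 3, 5, 6}) (Sc {#a, b#})"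
    unfolding alg_hom_def carrier using ab
    by (auto simp: Sc_def add_SR6 mul_SR6 dest: size_mset_mono)
  moreover have "bij_betw ?h {1, 3, 5, 6} {None, Some {#a#}, Some {#b#}, Some {#a, b#}}"
    using ab by (auto simp: bij_betw_def inj_on_def)
  ultimately show ?thesis
    unfolding alg_iso_def carrier by auto
qed

lemma variety_of_iso_SR6_on:
  assumes inf: "infinite (UNIV :: 'u set)" and iso: "alg_iso (SR6_on D) S"
    and D: "ai_semiring (SR6_on D)" "finite D"
  shows "(variety_of S :: 'u alg set) = models {(s, t). holds (SR6_on D) s t}"
proof -
  have "finite (carrier S)"
    using iso D(2) by (auto simp: alg_iso_def dest: bij_betw_finite)
  moreover have "holds (SR6_on D) s t \<longleftrightarrow> holds S s t" for s t :: "'u trm"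
    using iso_holds_iff[OF iso ai_semiring_closed[OF D(1)]] .
  ultimately show ?thesis
    using variety_of_eq_models[OF inf iso_ai_semiring[OF iso D(1)]] by simp
qed

text \<open>
  Each law of the locale is an identity of \<open>SR6\<close> once \<open>\<zero>\<close> is written as a square; all squares
  agree because \<open>x x = y y\<close> is such an identity.
\<close>

lemma nil_ai_semiring_if_SR6_identities:
  assumes inf: "infinite (UNIV :: 'u set)" and B: "ai_semiring B"
    and ids: "\<And>s t :: 'u trm. holds SR6 s t \<Longrightarrow> holds B s t"
  obtains z where "nil_ai_semiring B z"
proof -
  obtain i :: "nat \<Rightarrow> 'u" where "inj i"
    using infinite_countable_subset[OF inf] by blast
  then have i [simp]: "i m = i n \<longleftrightarrow> m = n" for m n
    by (simp add: inj_eq)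
  define X Y Z where "X = Var (i 0)" and "Y = Var (i 1)" and "Z = Var (i 2)"
  have inst: "eval B (\<lambda>u. if u = i 0 then x else if u = i 1 then y else z) s =
      eval B (\<lambda>u. if u = i 0 then x else if u = i 1 then y else z) t"
    if "holds SR6 s t" "x \<in> carrier B" "y \<in> carrier B" "z \<in> carrier B" for s t x y z
    using ids[OF that(1)] that(2-4) unfolding holds_def by (simp add: image_subset_iff)
  have ident: "holds SR6 s t"
    if "\<And>v. \<lbrakk>\<And>u. v u \<in> carrier SR6\<rbrakk> \<Longrightarrow> eval SR6 v s = eval SR6 v t" for s t :: "'u trm"
    using that by (simp add: holds_def image_subset_iff)
  have "holds SR6 (Times X Y) (Times Y X)" "holds SR6 (Times X X) (Times Y Y)"
    "holds SR6 (Times (Times X Y) Z) (Times X X)" "holds SR6 (Plus X (Times Y Y)) (Times Y Y)"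
    "holds SR6 (Plus X (Times X Y)) (Times X X)"
    unfolding X_def Y_def Z_def by (rule ident; force simp: add_SR6 mul_SR6)+
  note laws = this[THEN inst, unfolded X_def Y_def Z_def, simplified]
  obtain c where c: "c \<in> carrier B"
    using B by (auto simp: ai_semiring_def)
  have square: "mul B x x = mul B c c" if "x \<in> carrier B" for x
    using laws(2)[of x c c] that c by simp
  have "nil_ai_semiring B (mul B c c)"
  proof
    show "ai_semiring B" "mul B c c \<in> carrier B"
      using B c by (auto simp: ai_semiring_def)
    fix x y z assume x: "x \<in> carrier B" and y: "y \<in> carrier B"
    show "mul B x y = mul B y x"
      using laws(1)[of x y c] x y c by simp
    show "mul B x x = mul B c c"
      using square x .
    show "add B x (mul B c c) = mul B c c"
      using laws(4)[of x c c] x c by simp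
    show "add B x (mul B x y) = mul B c c"
      using laws(5)[of x y c] x y c square[OF x] by simp
    show "mul B (mul B x y) z = mul B c c" if "z \<in> carrier B"
      using laws(3)[of x y z] x y that square[OF x] by simp
  qed
  then show thesis
    by (rule that)
qed

lemma trivial_variety_eq_models:
  assumes inf: "infinite (UNIV :: 'u set)"
  shows "(trivial_variety :: 'u alg set) = models UNIV"
proof -
  obtain x y :: 'u where xy: "y \<noteq> x"
    using ex_new_if_finite[OF inf, of "{undefined}"] by auto
  have "card (carrier A) = 1 \<longleftrightarrow> (\<forall>s t :: 'u trm. holds A s t)" if A: "ai_semiring A" for A :: "'u alg"
  proof
    assume "card (carrier A) = 1"
    then obtain c where "carrier A = {c}"
      by (auto simp: card_1_singleton_iff)
    then have "eval A v s = c" if "range v \<subseteq> carrier A" for v s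
      using eval_in_carrier[OF ai_semiring_closed[OF A] that] by blast
    then show "\<forall>s t :: 'u trm. holds A s t"
      by (metis holds_def)
  next
    assume all: "\<forall>s t :: 'u trm. holds A s t"
    have "c = d" if "c \<in> carrier A" "d \<in> carrier A" for c d
    proof -
      have "range (\<lambda>u. if u = x then c else d) \<subseteq> carrier A"
        using that by auto
      moreover have "holds A (Var x) (Var y)"
        using all by blast
      ultimately have "eval A (\<lambda>u. if u = x then c else d) (Var x) =
          eval A (\<lambda>u. if u = x then c else d) (Var y)"
        unfolding holds_def by blast
      then show ?thesis
        using xy by simp
    qed
    moreover obtain c where "c \<in> carrier A"
      using A by (auto simp: ai_semiring_def)
    ultimately have "carrier A = {c}"
      by blast
    then show "card (carrier A) = 1"
      by simp
  qed
  then show ?thesis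
    by (auto simp: trivial_variety_def models_def)
qed

lemma models_antimono: "\<Gamma> \<subseteq> \<Delta> \<Longrightarrow> models \<Delta> \<subseteq> models \<Gamma>"
  by (auto simp: models_def)

lemma models_strict_subset:
  assumes inf: "infinite (UNIV :: 'u set)" and S: "ai_semiring S" "finite (carrier S)"
    and sub: "{(s, t). holds S s t} \<subseteq> \<Delta>" and st: "(s, t) \<in> \<Delta>" "\<not> holds S s t"
  shows "(models \<Delta> :: 'u alg set) \<subset> models {(s, t). holds S s t}"
proof -
  obtain B :: "'u alg" where B: "alg_iso S B"
    using finite_alg_copy[OF inf S(2)] .
  have transfer: "holds S s t \<longleftrightarrow> holds B s t" for s t :: "'u trm"
    using iso_holds_iff[OF B ai_semiring_closed[OF S(1)]] .
  have "B \<in> models {(s, t). holds S s t}" "B \<notin> models \<Delta>"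
    using iso_ai_semiring[OF B S(1)] transfer st by (auto simp: models_def)
  then show ?thesis
    using models_antimono[OF sub] by blast
qed

lemma not_holds_SR6_onI:
  "range v \<subseteq> D \<Longrightarrow> eval SR6 v s \<noteq> eval SR6 v t \<Longrightarrow> \<not> holds (SR6_on D) s t"
  by (auto simp: holds_def)

theorem proposition5p3:
  fixes a b :: 'x
  assumes "infinite (UNIV :: 'u set)"
    and "a \<noteq> b"
  shows "subvarieties (variety_of SR6 :: 'u alg set) =
           {trivial_variety, variety_of (Sc {#a#}), variety_of (Sc {#a, b#}), variety_of SR6} \<and>
         (trivial_variety :: 'u alg set) \<subset> variety_of (Sc {#a#}) \<and>
         (variety_of (Sc {#a#}) :: 'u alg set) \<subset> variety_of (Sc {#a, b#}) \<and>
         (variety_of (Sc {#a, b#}) :: 'u alg set) \<subset> variety_of SR6"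
proof -
  note inf = assms(1)
  define \<Gamma> :: "nat set \<Rightarrow> ('u trm \<times> 'u trm) set"
    where "\<Gamma> D = {(s, t). holds (SR6_on D) s t}" for D
  let ?D2 = "{1, 3} :: nat set" and ?D4 = "{1, 3, 5, 6} :: nat set" and ?D6 = "carrier SR6"
  have V2: "(variety_of (Sc {#a#}) :: 'u alg set) = models (\<Gamma> ?D2)"
    unfolding \<Gamma>_def
    by (rule variety_of_iso_SR6_on[OF inf Sc_single_iso ai_semiring_SR6_on_13]) simp
  have V4: "(variety_of (Sc {#a, b#}) :: 'u alg set) = models (\<Gamma> ?D4)"
    unfolding \<Gamma>_def
    by (rule variety_of_iso_SR6_on[OF inf Sc_pair_iso[OF assms(2)] ai_semiring_SR6_on_1356]) simp
  have V6: "(variety_of SR6 :: 'u alg set) = models (\<Gamma> ?D6)"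
    unfolding \<Gamma>_def SR6_on_carrier by (rule variety_of_eq_models[OF inf ai_semiring_SR6]) simp
  have T: "(trivial_variety :: 'u alg set) = models UNIV"
    using trivial_variety_eq_models[OF inf] .
  have \<Gamma>_iff: "(s, t) \<in> \<Gamma> D \<longleftrightarrow> holds (SR6_on D) s t" for s t D
    by (simp add: \<Gamma>_def)
  have \<Gamma>6_iff: "(s, t) \<in> \<Gamma> ?D6 \<longleftrightarrow> holds SR6 s t" for s t
    using \<Gamma>_iff[of s t ?D6] by (simp only: SR6_on_carrier)
  have models_iff: "B \<in> models \<Delta> \<longleftrightarrow> ai_semiring B \<and> (\<forall>s t. (s, t) \<in> \<Delta> \<longrightarrow> holds B s t)"
    for B :: "'u alg" and \<Delta>
    by (auto simp: models_def)
  have mono: "\<Gamma> D \<subseteq> \<Gamma> D'" if "D' \<subseteq> D" for D D' :: "nat set"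
    using that unfolding \<Gamma>_def holds_def by fastforce

  obtain i :: "nat \<Rightarrow> 'u" where "inj i"
    using infinite_countable_subset[OF inf] by blast
  then have i [simp]: "i m = i n \<longleftrightarrow> m = n" for m n
    by (simp add: inj_eq)
  define X1 X2 Y1 Y2 where "X1 = Var (i 0)" and "X2 = Var (i 1)" and "Y1 = Var (i 2)"
    and "Y2 = Var (i 3)"
  note vars = X1_def X2_def Y1_def Y2_def

  \<comment> \<open>The three strict inclusions are witnessed by \<open>x = y\<close>, \<open>x y = x x\<close> and the path law.\<close>
  have strict2: "models UNIV \<subset> (models (\<Gamma> ?D2) :: 'u alg set)"
    unfolding \<Gamma>_def
  proof (rule models_strict_subset[OF inf ai_semiring_SR6_on_13])
    show "\<not> holds (SR6_on {1, 3}) X1 X2"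
      by (rule not_holds_SR6_onI[of "\<lambda>u. if u = i 0 then 1 else 3"]) (auto simp: vars)
  qed simp_all
  have strict4: "models (\<Gamma> ?D2) \<subset> (models (\<Gamma> ?D4) :: 'u alg set)"
    unfolding \<Gamma>_def[of ?D4]
  proof (rule models_strict_subset[OF inf ai_semiring_SR6_on_1356])
    show "{(s, t). holds (SR6_on ?D4) s t} \<subseteq> \<Gamma> ?D2"
      using mono[of ?D2 ?D4] by (simp add: \<Gamma>_def)
    have "mul SR6 m n = 1" if "m \<in> ?D2" "n \<in> ?D2" for m n
      using that by (auto simp: mul_SR6)
    then show "(Times X1 X2, Times X1 X1) \<in> \<Gamma> ?D2"
      by (simp add: \<Gamma>_def vars holds_def image_subset_iff)
    show "\<not> holds (SR6_on ?D4) (Times X1 X2) (Times X1 X1)"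
      by (rule not_holds_SR6_onI[of "\<lambda>u. if u = i 0 then 5 else 6"]) (auto simp: vars mul_SR6)
  qed simp
  have strict6: "models (\<Gamma> ?D4) \<subset> (models (\<Gamma> ?D6) :: 'u alg set)"
    unfolding \<Gamma>_def[of ?D6] SR6_on_carrier
  proof (rule models_strict_subset[OF inf ai_semiring_SR6])
    let ?path = "Plus (Plus (Times X1 Y1) (Times X2 Y1)) (Times X2 Y2)"
    show "{(s, t). holds SR6 s t} \<subseteq> \<Gamma> ?D4"
      using mono[of ?D4 ?D6] by (simp add: \<Gamma>_def SR6_on_carrier del: carrier_SR6) simp
    let ?path_value = "\<lambda>p q r s. add SR6 (add SR6 (mul SR6 p r) (mul SR6 q r)) (mul SR6 q s)"
    have "\<forall>p\<in>?D4. \<forall>q\<in>?D4. \<forall>r\<in>?D4. \<forall>s\<in>?D4.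
        ?path_value p q r s = add SR6 (?path_value p q r s) (mul SR6 p s)"
      by (simp only: ball_simps simp_thms) (simp add: mul_SR6 add_SR6)
    then show "(?path, Plus ?path (Times X1 Y2)) \<in> \<Gamma> ?D4"
      by (simp only: \<Gamma>_def vars mem_Collect_eq prod.case holds_def eval_SR6_on SR6_on_simps
          eval.simps image_subset_iff ball_UNIV) blast
    have "\<not> holds (SR6_on ?D6) ?path (Plus ?path (Times X1 Y2))"
      by (rule not_holds_SR6_onI[of "\<lambda>u. if u = i 0 then 2 else if u = i 1 then 5
        else if u = i 2 then 6 else 4"]) (auto simp: vars mul_SR6 add_SR6)
    then show "\<not> holds SR6 ?path (Plus ?path (Times X1 Y2))"
      by (simp only: SR6_on_carrier not_False_eq_True)
  qed simp

  have subvariety_cases: "W \<in> {models UNIV, models (\<Gamma> ?D2), models (\<Gamma> ?D4), models (\<Gamma> ?D6)}"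
    if W: "ai_variety W" "W \<subseteq> models (\<Gamma> ?D6)" for W :: "'u alg set"
  proof -
    let ?Id = "identities W"
    have eq: "W = models ?Id"
      using variety_eq_models_identities[OF inf W(1)] .
    have nil: "\<exists>z. nil_ai_semiring B z" and SR6_ids: "\<And>s t :: 'u trm. holds SR6 s t \<Longrightarrow> holds B s t"
      and semiring: "ai_semiring B" and ids: "\<And>s t. (s, t) \<in> ?Id \<Longrightarrow> holds B s t" if "B \<in> W" for B
    proof -
      have B: "B \<in> models (\<Gamma> ?D6)"
        using that W(2) by blast
      then show ai: "ai_semiring B"
        by (simp add: models_def)
      show SR6: "holds B s t" if "holds SR6 s t" for s t :: "'u trm"
        using B that unfolding models_iff \<Gamma>6_iff by blast
      show "\<exists>z. nil_ai_semiring B z"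
        using nil_ai_semiring_if_SR6_identities[OF inf ai SR6] by blast
      show "holds B s t" if "(s, t) \<in> ?Id" for s t
        using that \<open>B \<in> W\<close> by (simp add: identities_def)
    qed
    \<comment> \<open>Either \<open>W\<close> contains the variety of the algebra, or it drops into the next smaller one.\<close>
    have above: "models (\<Gamma> D) \<subseteq> W" if "?Id \<subseteq> \<Gamma> D" for D
      using models_antimono[OF that] eq by simp
    have drop6: "W \<subseteq> models (\<Gamma> ?D4)" if not: "\<not> ?Id \<subseteq> \<Gamma> ?D6"
    proof
      fix B assume B: "B \<in> W"
      obtain z where "nil_ai_semiring B z"
        using nil[OF B] by blast
      then interpret nil_ai_semiring B z .
      obtain s t where st: "(s, t) \<in> ?Id" "\<not> holds SR6 s t"
        using not unfolding subset_iff split_paired_All \<Gamma>6_iff by blast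
      have path_law
        using path_law_if_identity_fails[OF ids[OF B st(1)] st(2)] .
      then show "B \<in> models (\<Gamma> ?D4)"
        using path_law_imp_identity[OF _ SR6_ids[OF B]] semiring[OF B] unfolding models_iff \<Gamma>_iff by blast
    qed
    have drop4: "W \<subseteq> models (\<Gamma> ?D2)" if not: "\<not> ?Id \<subseteq> \<Gamma> ?D4"
    proof
      fix B assume B: "B \<in> W"
      obtain z where "nil_ai_semiring B z"
        using nil[OF B] by blast
      then interpret nil_ai_semiring B z .
      obtain s t where st: "(s, t) \<in> ?Id" "\<not> holds (SR6_on ?D4) s t"
        using not unfolding subset_iff split_paired_All \<Gamma>_iff by blast
      have "mul B x y = z" if "x \<in> carrier B" "y \<in> carrier B" for x y
        using product_zero_if_identity_fails[OF ids[OF B st(1)] st(2) that] .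
      then show "B \<in> models (\<Gamma> ?D2)"
        using product_zero_imp_identity semiring[OF B] unfolding models_iff \<Gamma>_iff by blast
    qed
    have drop2: "W \<subseteq> models UNIV" if not: "\<not> ?Id \<subseteq> \<Gamma> ?D2"
    proof
      fix B assume B: "B \<in> W"
      obtain z where "nil_ai_semiring B z"
        using nil[OF B] by blast
      then interpret nil_ai_semiring B z .
      obtain s t where st: "(s, t) \<in> ?Id" "\<not> holds (SR6_on ?D2) s t"
        using not unfolding subset_iff split_paired_All \<Gamma>_iff by blast
      have "carrier B = {z}"
        using trivial_if_identity_fails[OF ids[OF B st(1)] st(2)] zero_closed by blast
      then have "B \<in> trivial_variety"
        using semiring[OF B] by (simp add: trivial_variety_def)
      then show "B \<in> models UNIV"
        by (simp only: T)
    qed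
    have "models UNIV \<subseteq> W"
      using models_antimono[of ?Id UNIV] eq by simp
    then show ?thesis
      using above drop6 drop4 drop2 W(2) by blast
  qed
  have "subvarieties (models (\<Gamma> ?D6)) =
      {models UNIV, models (\<Gamma> ?D2), models (\<Gamma> ?D4), models (\<Gamma> ?D6) :: 'u alg set}"
  proof (rule equalityI; rule subsetI)
    fix W :: "'u alg set" assume "W \<in> subvarieties (models (\<Gamma> ?D6))"
    then show "W \<in> {models UNIV, models (\<Gamma> ?D2), models (\<Gamma> ?D4), models (\<Gamma> ?D6)}"
      unfolding subvarieties_def mem_Collect_eq by (elim conjE) (rule subvariety_cases)
  next
    fix W :: "'u alg set"
    assume "W \<in> {models UNIV, models (\<Gamma> ?D2), models (\<Gamma> ?D4), models (\<Gamma> ?D6)}"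
    then have "W \<subseteq> models (\<Gamma> ?D6)" "\<exists>\<Delta>. W = models \<Delta>"
      using strict2 strict4 strict6 by (elim insertE emptyE; blast)+
    then show "W \<in> subvarieties (models (\<Gamma> ?D6))"
      using models_variety unfolding subvarieties_def by blast
  qed
  then show ?thesis
    unfolding V2 V4 V6 T by (intro conjI strict2 strict4 strict6)
qed

end
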